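(* For every $k \geq 0$, there exist non-isomorphic graphs $G$ and $H$ that are homomorphism indistinguishable over all graphs of vortex-free Hadwiger number $\leq k$.
   Context: All graphs are finite, simple and loopless. Two graphs $G$ and $H$ are homomorphism indistinguishable over a graph class $\mathcal{F}$ if $\hom(F,G)=\hom(F,H)$ for every $F\in\mathcal{F}$, where $\hom(F,G)$ is the number of homomorphisms $F\to G$. For $g,d\geq 0$, let $\mathcal{C}_{g,d}$ be the class of graphs $G$ having a set $S\subseteq V(G)$ with $|S|\leq d$ such that $G-S$ has Euler genus $\leq g$. For a graph $G$ and $X\subseteq V(G)$, the torso of $G$ on $X$ is the graph with vertex set $X$ whose edges are the edges of $G$ with both endpoints in $X$ together with all pairs $xy$ with $x,y\in N_G(C)$ for some connected component $C$ of $G-X$. For a graph class $\mathcal{C}$ and $s\geq 0$, $\mathcal{C}^{\oplus s}$ is the class of graphs $G$ admitting a tree decomposition $(T,\beta)$ such that $|\beta(t)\cap\beta(t')|\leq s$ for every edge $tt'\in E(T)$ and the torso of $G$ on $\beta(t)$ lies in $\mathcal{C}$ for every $t\in V(T)$. The vortex-free Hadwiger number of a graph $G$ is the minimum $k\geq 0$ such that $G\in\mathcal{C}_{k,k}^{\oplus k}$. *)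

theory Defs
  imports
    "Graph_Theory.Digraph_Isomorphism"
    "HOL-Combinatorics.Orbits"
    "HOL-Library.FuncSet"
begin

text \<open>
  A (finite, simple, loopless) graph is a \<open>pair_graph\<close> of the entry Graph_Theory: a finite vertex
  set \<open>pverts G\<close> and a symmetric irreflexive set \<open>parcs G\<close> of ordered pairs, so that each
  undirected edge \<open>uv\<close> occurs as the two arcs \<open>(u, v)\<close> and \<open>(v, u)\<close>.  The connected components
  of a symmetric digraph are its strongly connected components, \<open>sccs_verts\<close>.
\<close>

subsection \<open>Elementary notions\<close>

definition nbrs :: "'a pair_pre_digraph \<Rightarrow> 'a \<Rightarrow> 'a set" where
  "nbrs G v = {w. (v, w) \<in> parcs G}"

definition set_nbrs :: "'a pair_pre_digraph \<Rightarrow> 'a set \<Rightarrow> 'a set" where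
  "set_nbrs G C = {w. w \<notin> C \<and> (\<exists>v\<in>C. (v, w) \<in> parcs G)}"

definition edges :: "'a pair_pre_digraph \<Rightarrow> 'a set set" where
  "edges G = {{u, v} | u v. (u, v) \<in> parcs G}"

definition induced :: "'a pair_pre_digraph \<Rightarrow> 'a set \<Rightarrow> 'a pair_pre_digraph" where
  "induced G X = \<lparr>pverts = pverts G \<inter> X, parcs = {(u, v) \<in> parcs G. u \<in> X \<and> v \<in> X}\<rparr>"

definition remove_verts :: "'a pair_pre_digraph \<Rightarrow> 'a set \<Rightarrow> 'a pair_pre_digraph" where
  "remove_verts G X = induced G (pverts G - X)"

definition components :: "'a pair_pre_digraph \<Rightarrow> 'a set set" where
  "components G = pre_digraph.sccs_verts (with_proj G)"

definition isomorphic :: "'a pair_pre_digraph \<Rightarrow> 'b pair_pre_digraph \<Rightarrow> bool" where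
  "isomorphic G H \<longleftrightarrow> digraph_iso (with_proj G) (with_proj H)"

lemma with_proj_induced: "X \<subseteq> pverts G \<Longrightarrow> with_proj (induced G X) = with_proj G \<restriction> X"
  by (auto simp: induced_def with_proj_def induce_subgraph_def)

lemma pair_graph_induced:
  assumes "pair_graph G"
  shows "pair_graph (induced G X)"
proof -
  interpret pair_graph G by (fact assms)
  have "finite (parcs (induced G X))"
    by (rule finite_subset[OF _ pair_finite_arcs]) (auto simp: induced_def)
  moreover have "finite (pverts (induced G X))"
    using pair_finite_verts by (simp add: induced_def)
  moreover have "symmetric (with_proj (induced G X))"
    using arcs_symmetric by (auto simp: symmetric_def induced_def intro!: symI)
  ultimately show ?thesis
    by unfold_locales (auto simp: induced_def dest: in_arcsD1 in_arcsD2 no_loops')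
qed


subsection \<open>Homomorphism indistinguishability\<close>

definition homs :: "'a pair_pre_digraph \<Rightarrow> 'b pair_pre_digraph \<Rightarrow> ('a \<Rightarrow> 'b) set" where
  "homs F G = {h \<in> pverts F \<rightarrow>\<^sub>E pverts G. \<forall>(u, v)\<in>parcs F. (h u, h v) \<in> parcs G}"

definition hom_count :: "'a pair_pre_digraph \<Rightarrow> 'b pair_pre_digraph \<Rightarrow> nat" where
  "hom_count F G = card (homs F G)"

definition hom_indistinguishable ::
    "'a pair_pre_digraph set \<Rightarrow> 'b pair_pre_digraph \<Rightarrow> 'c pair_pre_digraph \<Rightarrow> bool" where
  "hom_indistinguishable \<F> G H \<longleftrightarrow> (\<forall>F\<in>\<F>. hom_count F G = hom_count F H)"


subsection \<open>Euler genus\<close>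

text \<open>
  Graph embeddings in surfaces, orientable or not, are described combinatorially in the standard
  way (Mohar and Thomassen, \<^emph>\<open>Graphs on Surfaces\<close>): an embedding scheme consists of a rotation
  system \<open>\<pi>\<close>, i.e. a cyclic permutation \<open>\<pi> v\<close> of the edges at each vertex \<open>v\<close>, and a signature
  \<open>\<lambda> : E(G) \<rightarrow> {+1, -1}\<close>.  As graphs are simple, the edges at \<open>v\<close> are identified with
  the neighbours of \<open>v\<close>; the signature \<open>sg\<close> is Boolean, with \<open>True\<close> for \<open>+1\<close>.
\<close>

definition rotation_system :: "'a pair_pre_digraph \<Rightarrow> ('a \<Rightarrow> 'a \<Rightarrow> 'a) \<Rightarrow> bool" where
  "rotation_system G \<pi> \<longleftrightarrow> (\<forall>v\<in>pverts G. \<pi> v permutes nbrs G v \<and>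
     (nbrs G v \<noteq> {} \<longrightarrow> cyclic_on (\<pi> v) (nbrs G v)))"

text \<open>
  Face tracing.  The state \<open>((u, v), s)\<close> stands for walking along the edge \<open>uv\<close> from \<open>u\<close> to \<open>v\<close>,
  \<open>s\<close> telling whether the walk turned in clockwise (\<open>True\<close>) or anticlockwise (\<open>False\<close>) direction at \<open>u\<close>.
  An edge of negative signature interchanges the two directions.
\<close>

definition face_step ::
    "('a \<Rightarrow> 'a \<Rightarrow> 'a) \<Rightarrow> ('a set \<Rightarrow> bool) \<Rightarrow> ('a \<times> 'a) \<times> bool \<Rightarrow> ('a \<times> 'a) \<times> bool" where
  "face_step \<pi> sg = (\<lambda>((u, v), s). let s' = (s = sg {u, v}) in
     ((v, (if s' then \<pi> v else inv (\<pi> v)) u), s'))"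

text \<open>The state of the same facial walk, traversed backwards, that walks along the same edge.\<close>

definition face_reverse :: "('a set \<Rightarrow> bool) \<Rightarrow> ('a \<times> 'a) \<times> bool \<Rightarrow> ('a \<times> 'a) \<times> bool" where
  "face_reverse sg = (\<lambda>((u, v), s). ((v, u), s \<noteq> sg {u, v}))"

text \<open>
  A facial walk and its reversal describe the same face.  An isolated vertex contributes one
  further face, which has no edges on its boundary.
\<close>

definition faces ::
    "'a pair_pre_digraph \<Rightarrow> ('a \<Rightarrow> 'a \<Rightarrow> 'a) \<Rightarrow> ('a set \<Rightarrow> bool) \<Rightarrow> (('a \<times> 'a) \<times> bool) set set" where
  "faces G \<pi> sg =
     {orbit (face_step \<pi> sg) x \<union> orbit (face_step \<pi> sg) (face_reverse sg x) | x.
        x \<in> parcs G \<times> UNIV}"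

definition face_count :: "'a pair_pre_digraph \<Rightarrow> ('a \<Rightarrow> 'a \<Rightarrow> 'a) \<Rightarrow> ('a set \<Rightarrow> bool) \<Rightarrow> nat" where
  "face_count G \<pi> sg = card (faces G \<pi> sg) + card {v \<in> pverts G. nbrs G v = {}}"

text \<open>
  For connected \<open>G\<close>, this is Euler's formula \<open>|V| - |E| + |F| = 2 - eg\<close>.  For disconnected \<open>G\<close>, it is
  the sum over the components, since the scheme embeds each component in a surface of its own,
  and the connected sum of these surfaces contains \<open>G\<close>.
\<close>

definition scheme_genus :: "'a pair_pre_digraph \<Rightarrow> ('a \<Rightarrow> 'a \<Rightarrow> 'a) \<Rightarrow> ('a set \<Rightarrow> bool) \<Rightarrow> int" where
  "scheme_genus G \<pi> sg = 2 * int (card (components G)) - int (card (pverts G))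
     + int (card (edges G)) - int (face_count G \<pi> sg)"

definition euler_genus :: "'a pair_pre_digraph \<Rightarrow> nat" where
  "euler_genus G = (LEAST g. \<exists>\<pi> sg. rotation_system G \<pi> \<and> scheme_genus G \<pi> sg \<le> int g)"

definition near_genus_class :: "nat \<Rightarrow> nat \<Rightarrow> 'a pair_pre_digraph set" where
  "near_genus_class g d = {G. pair_graph G \<and>
     (\<exists>S \<subseteq> pverts G. card S \<le> d \<and> euler_genus (remove_verts G S) \<le> g)}"


subsection \<open>Tree decompositions\<close>

definition torso :: "'a pair_pre_digraph \<Rightarrow> 'a set \<Rightarrow> 'a pair_pre_digraph" where
  "torso G X = \<lparr>pverts = X, parcs = {(x, y). x \<in> X \<and> y \<in> X \<and>
     ((x, y) \<in> parcs G \<or>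
      x \<noteq> y \<and> (\<exists>C\<in>components (remove_verts G X). x \<in> set_nbrs G C \<and> y \<in> set_nbrs G C))}\<rparr>"

text \<open>
  \<open>forest\<close> of Graph_Theory is of no use here: for symmetric digraphs, it counts an edge traversed
  back and forth as a cycle.
\<close>

definition tree_graph :: "'a pair_pre_digraph \<Rightarrow> bool" where
  "tree_graph T \<longleftrightarrow> pair_graph T \<and> connected (with_proj T) \<and>
     (\<nexists>p. pre_digraph.cycle (with_proj T) p \<and> length p \<ge> 3)"

definition tree_decomposition ::
    "'a pair_pre_digraph \<Rightarrow> 't pair_pre_digraph \<Rightarrow> ('t \<Rightarrow> 'a set) \<Rightarrow> bool" where
  "tree_decomposition G T \<beta> \<longleftrightarrow> tree_graph T \<and>
     (\<Union>t\<in>pverts T. \<beta> t) = pverts G \<and>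
     (\<forall>(u, v)\<in>parcs G. \<exists>t\<in>pverts T. u \<in> \<beta> t \<and> v \<in> \<beta> t) \<and>
     (\<forall>v\<in>pverts G. connected (with_proj (induced T {t \<in> pverts T. v \<in> \<beta> t})))"

text \<open>The class \<open>\<C>\<^sup>\<oplus>\<^sup>s\<close>. Decomposition trees are finite, so their nodes may be taken to be natural numbers.\<close>

definition sum_class :: "'a pair_pre_digraph set \<Rightarrow> nat \<Rightarrow> 'a pair_pre_digraph set" where
  "sum_class \<C> s = {G. pair_graph G \<and>
     (\<exists>(T :: nat pair_pre_digraph) \<beta>. tree_decomposition G T \<beta> \<and>
        (\<forall>(t, t')\<in>parcs T. card (\<beta> t \<inter> \<beta> t') \<le> s) \<and>
        (\<forall>t\<in>pverts T. torso G (\<beta> t) \<in> \<C>))}"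

definition vortex_free_hadwiger :: "'a pair_pre_digraph \<Rightarrow> nat" where
  "vortex_free_hadwiger G = (LEAST k. G \<in> sum_class (near_genus_class k k) k)"

end

theory Submission
  imports Defs "HOL-Library.Z2" "HOL-Library.Nat_Bijection"
begin

text \<open>
  \<open>G\<close> and \<open>H\<close> are the untwisted and the twisted CFI graph of a complete graph \<open>K\<^sub>n\<close>.  Over each
  homomorphism \<open>\<phi>\<close> from \<open>F\<close> to \<open>K\<^sub>n\<close>, the homomorphisms to \<open>H\<close> and \<open>G\<close> are the solutions of a linear
  system over the field with two elements and of its homogeneous version, so different counts yield
  a certificate of insolubility: vertex weights on \<open>F\<close> with odd sum on each fibre of \<open>\<phi>\<close> and even sum
  on each component of the preimage of each edge.  This is a homological version of a \<open>K\<^sub>n\<close> minor.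
  It can be pushed to a torso of a tree decomposition of small adhesion, and it survives the deletion
  of few vertices for a slightly smaller \<open>n\<close>.  In an embedded graph, the paths given by the weights turn
  each \<open>K\<^sub>5\<close> into two cycles of intersection number one, and disjoint copies give
  orthogonal pairs, so the Euler genus is at least the number of disjoint copies.
\<close>

text \<open>For a fixed \<open>\<phi>\<close>, the homomorphisms to the twisted graph form a
  translate of those to the untwisted one or do not exist at all. In the second case linear algebra
  yields only weights: nothing makes the fibres of \<open>\<phi>\<close> connected, so no branch
  sets of a minor can be read off, and every step has to be carried out with chains modulo 2. The
  delicate point is the odd weight of the fibres. Restricting to a bag eliminates vertices one by
  one, and a vertex whose weight cannot be absorbed by its own fibre flips all fibres at once; this
  is why the parity is a parameter of \<open>model\<close> and why the right bag must be chosen.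
  Deleting vertices for good is simpler: the fibres containing them are given up. Coefficients
  modulo 2 also treat orientable and non-orientable embeddings alike. Five vertices are what two
  triangles with a single common vertex need, and such pairs supply the crossing cycles.\<close>

subsection \<open>Linear algebra over the field with two elements\<close>

text \<open>These rewrite rules would replace the field operations by bitwise ones.\<close>

declare add_bit_eq_xor [simp del] mult_bit_eq_and [simp del]

lemma bit_add_self [simp]: "(x::bit) + x = 0"
  by (cases x) (simp_all add: one_add_one)

lemma bit_add_self_left [simp]: "(x::bit) + (x + y) = y"
  by (simp flip: add.assoc)

lemma bit_add_eq_0_iff: "(x::bit) + y = 0 \<longleftrightarrow> x = y"
  by (cases x; cases y) simp_all

text \<open>The terms off the diagonal cancel in pairs. This yields both the even sums in
  \<open>cfi_system\<close> and the contradiction in \<open>cfi_not_isomorphic\<close>.\<close>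

lemma sum_bit_sym:
  fixes f :: "'a \<Rightarrow> 'a \<Rightarrow> bit"
  assumes "finite X" "\<And>a b. a \<in> X \<Longrightarrow> b \<in> X \<Longrightarrow> f a b = f b a" "\<And>a. a \<in> X \<Longrightarrow> f a a = 0"
  shows "(\<Sum>a\<in>X. \<Sum>b\<in>X. f a b) = 0"
  using assms
proof (induction X rule: finite_induct)
  case (insert x X)
  have "(\<Sum>a\<in>insert x X. \<Sum>b\<in>insert x X. f a b)
      = (f x x + (\<Sum>b\<in>X. f x b)) + (\<Sum>a\<in>X. f a x + (\<Sum>b\<in>X. f a b))"
    using insert.hyps by simp
  also have "\<dots> = (\<Sum>b\<in>X. f x b) + (\<Sum>a\<in>X. f a x) + (\<Sum>a\<in>X. \<Sum>b\<in>X. f a b)"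
    using insert.prems by (simp add: sum.distrib add.assoc)
  also have "(\<Sum>a\<in>X. f a x) = (\<Sum>b\<in>X. f x b)"
    using insert.prems by (intro sum.cong) auto
  finally show ?case using insert by simp
qed simp

text \<open>Gaussian elimination, one unknown at a time. A failing system yields a combination
  \<open>y\<close> of its equations that reads 0 = 1; certificates and chains both come from this
  dichotomy.\<close>

lemma bit_system_alternative:
  fixes A :: "'i \<Rightarrow> 'j \<Rightarrow> bit" and b :: "'i \<Rightarrow> bit"
  assumes "finite J" "finite I"
  shows "(\<exists>x. \<forall>i\<in>I. (\<Sum>j\<in>J. A i j * x j) = b i) \<or>
    (\<exists>y. (\<forall>j\<in>J. (\<Sum>i\<in>I. y i * A i j) = 0) \<and> (\<Sum>i\<in>I. y i * b i) = 1)"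
  using assms
proof (induction J arbitrary: I A b rule: finite_induct)
  case empty
  show ?case
  proof (cases "\<forall>i\<in>I. b i = 0")
    case False
    then obtain i where "i \<in> I" "b i = 1" by auto
    then have "(\<Sum>k\<in>I. of_bool (k = i) * b k) = 1"
      using empty by (simp add: of_bool_def if_distrib if_distribR cong: if_cong)
    then show ?thesis by (intro disjI2 exI[of _ "\<lambda>k. of_bool (k = i)"]) simp
  qed simp
next
  case (insert j0 J)
  show ?case
  proof (cases "\<forall>i\<in>I. A i j0 = 0")
    case True
    from insert.IH[OF insert.prems, of A b] show ?thesis
    proof
      assume "\<exists>x. \<forall>i\<in>I. (\<Sum>j\<in>J. A i j * x j) = b i"
      then show ?thesis using True insert.hyps by auto
    next
      assume "\<exists>y. (\<forall>j\<in>J. (\<Sum>i\<in>I. y i * A i j) = 0) \<and> (\<Sum>i\<in>I. y i * b i) = 1"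
      then show ?thesis using True by auto
    qed
  next
    case False
    then obtain i0 where i0: "i0 \<in> I" "A i0 j0 = 1" by auto
    define I' where "I' = I - {i0}"
    have I: "I = insert i0 I'" "i0 \<notin> I'" "finite I'" using i0 insert.prems by (auto simp: I'_def)
    \<comment> \<open>Adding the pivot row \<open>i0\<close> where necessary clears column
      \<open>j0\<close> in all other rows.\<close>
    let ?A = "\<lambda>i j. A i j + A i j0 * A i0 j" and ?b = "\<lambda>i. b i + A i j0 * b i0"
    from insert.IH[OF I(3), of ?A ?b] show ?thesis
    proof
      assume "\<exists>x. \<forall>i\<in>I'. (\<Sum>j\<in>J. ?A i j * x j) = ?b i"
      then obtain x where x: "\<And>i. i \<in> I' \<Longrightarrow> (\<Sum>j\<in>J. ?A i j * x j) = ?b i" by auto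
      define s where "s = (\<Sum>j\<in>J. A i0 j * x j)"
      define x' where "x' = x(j0 := b i0 + s)"
      have eq: "(\<Sum>j\<in>insert j0 J. A i j * x' j) = A i j0 * (b i0 + s) + (\<Sum>j\<in>J. A i j * x j)" for i
      proof -
        have "(\<Sum>j\<in>J. A i j * x' j) = (\<Sum>j\<in>J. A i j * x j)"
          using insert.hyps by (intro sum.cong) (auto simp: x'_def)
        then show ?thesis using insert.hyps by (simp add: x'_def)
      qed
      have "(\<Sum>j\<in>insert j0 J. A i j * x' j) = b i" if "i \<in> I" for i
      proof (cases "i = i0")
        case True
        then show ?thesis using i0 by (simp only: eq) (simp add: s_def add.assoc)
      next
        case False
        then have "i \<in> I'" using that by (simp add: I'_def)
        from x[OF this] have "(\<Sum>j\<in>J. A i j * x j) + A i j0 * s = b i + A i j0 * b i0"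
          by (simp add: s_def algebra_simps sum.distrib sum_distrib_left)
        then have "(\<Sum>j\<in>J. A i j * x j) = b i + A i j0 * b i0 + A i j0 * s"
          by (metis add.assoc add.commute bit_add_self_left)
        then show ?thesis by (simp only: eq) (simp add: algebra_simps)
      qed
      then show ?thesis by blast
    next
      assume "\<exists>y. (\<forall>j\<in>J. (\<Sum>i\<in>I'. y i * ?A i j) = 0) \<and> (\<Sum>i\<in>I'. y i * ?b i) = 1"
      then obtain y where y: "\<And>j. j \<in> J \<Longrightarrow> (\<Sum>i\<in>I'. y i * ?A i j) = 0"
        "(\<Sum>i\<in>I'. y i * ?b i) = 1" by auto
      \<comment> \<open>The pivot row gets the coefficient that makes column \<open>j0\<close>
        vanish.\<close>
      define y' where "y' = y(i0 := (\<Sum>i\<in>I'. y i * A i j0))"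
      have eq: "(\<Sum>i\<in>I. y' i * f i) = (\<Sum>i\<in>I'. y i * (f i + A i j0 * f i0))" for f
      proof -
        have "(\<Sum>i\<in>I'. y' i * f i) = (\<Sum>i\<in>I'. y i * f i)"
          using I by (intro sum.cong) (auto simp: y'_def)
        then show ?thesis using I
          by (simp add: y'_def algebra_simps sum.distrib sum_distrib_left)
      qed
      have "(\<Sum>i\<in>I. y' i * A i j0) = 0" unfolding eq using i0 by simp
      then show ?thesis using y by (intro disjI2 exI[of _ y']) (simp add: eq)
    qed
  qed
qed

lemma sum_telescope_bit: "(\<Sum>i<n. f i + f (Suc i)) = f 0 + (f n :: bit)"
  by (induction n) (simp_all add: add.assoc)

subsection \<open>Homological minors\<close>

lemma sum_of_bool_delta: "finite X \<Longrightarrow> (\<Sum>a\<in>X. of_bool (a = c)) = (of_bool (c \<in> X) :: bit)"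
  by (simp add: of_bool_def del: sum_of_bool_eq)

text \<open>For symmetric \<open>E\<close>, these are the unions of components of the subgraph
  induced on \<open>U\<close>; on finite sets, being even on all of them means being even on each
  component.\<close>

definition closed_in :: "('a \<times> 'a) set \<Rightarrow> 'a set \<Rightarrow> 'a set \<Rightarrow> bool" where
  "closed_in E U X \<longleftrightarrow> X \<subseteq> U \<and> (\<forall>a\<in>X. \<forall>b\<in>U. (a, b) \<in> E \<longrightarrow> b \<in> X)"

text \<open>
  The complete graph on \<open>W\<close> as a minor, up to homology over the field with two elements: the branch
  set of \<open>w\<close> becomes the 0-chain \<open>y\<close> on the fibre over \<open>w\<close>, and the edge \<open>ww'\<close> becomes the condition that
  \<open>y\<close> is a boundary on the fibres over \<open>w\<close> and \<open>w'\<close>.  The parity \<open>\<sigma>\<close> is 1 for genuine minors; the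
  elimination of vertices may change it.
\<close>

definition model ::
    "'a set \<Rightarrow> ('a \<times> 'a) set \<Rightarrow> 'w set \<Rightarrow> ('a \<Rightarrow> 'w) \<Rightarrow> bit \<Rightarrow> ('a \<Rightarrow> bit) \<Rightarrow> bool" where
  "model V E W \<phi> \<sigma> y \<longleftrightarrow> (\<forall>w\<in>W. sum y {a \<in> V. \<phi> a = w} = \<sigma>) \<and>
     (\<forall>w\<in>W. \<forall>w'\<in>W. \<forall>X. w \<noteq> w' \<and> closed_in E {a \<in> V. \<phi> a \<in> {w, w'}} X \<longrightarrow> sum y X = 0)"

lemma modelD1: "model V E W \<phi> \<sigma> y \<Longrightarrow> w \<in> W \<Longrightarrow> sum y {a \<in> V. \<phi> a = w} = \<sigma>"
  by (simp add: model_def)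

lemma modelD2: "model V E W \<phi> \<sigma> y \<Longrightarrow> w \<in> W \<Longrightarrow> w' \<in> W \<Longrightarrow> w \<noteq> w' \<Longrightarrow>
    closed_in E {a \<in> V. \<phi> a \<in> {w, w'}} X \<Longrightarrow> sum y X = 0"
  unfolding model_def by blast

text \<open>More arcs leave fewer closed sets. Thus inclusions between arc sets suffice when torsos
  are compared.\<close>

lemma model_mono:
  assumes "model V E W \<phi> \<sigma> y" "E \<subseteq> E'"
  shows "model V E' W \<phi> \<sigma> y"
proof -
  have "closed_in E U X" if "closed_in E' U X" for U X
    using that assms(2) unfolding closed_in_def by blast
  then show ?thesis using assms(1) unfolding model_def by blast
qed

definition eliminate :: "('a \<times> 'a) set \<Rightarrow> 'a \<Rightarrow> ('a \<times> 'a) set" where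
  "eliminate E c =
     {(x, y). x \<noteq> c \<and> y \<noteq> c \<and> x \<noteq> y \<and> ((x, y) \<in> E \<or> (x, c) \<in> E \<and> (c, y) \<in> E)}"

text \<open>
  Three cases: if \<open>c\<close> carries no weight, forget it; if \<open>c\<close> has a neighbour in its own fibre, move
  the weight there; otherwise \<open>c\<close> has a neighbour in every other fibre, and moving the
  weight to one neighbour in each of them changes the parity of all fibres simultaneously.
\<close>

lemma model_eliminate:
  assumes "finite V" "sym E" "irrefl E" "c \<in> V" and M: "model V E W \<phi> \<sigma> y"
    and EV: "E \<subseteq> V \<times> V"
  shows "\<exists>\<sigma>' y'. model (V - {c}) (eliminate E c) W \<phi> \<sigma>' y' \<and> (\<forall>a. (c, a) \<notin> E \<longrightarrow> y' a = y a)"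
proof -
  let ?E = "eliminate E c"
  let ?U = "\<lambda>w w'. {a \<in> V. \<phi> a \<in> {w, w'}}" and ?U' = "\<lambda>w w'. {a \<in> V - {c}. \<phi> a \<in> {w, w'}}"
  have cc: "(c, c) \<notin> E" using \<open>irrefl E\<close> by (simp add: irrefl_def)
  have s: "(b, a) \<in> E" if "(a, b) \<in> E" for a b using that \<open>sym E\<close> by (rule symD[rotated])
  \<comment> \<open>Elimination turns the neighbours of \<open>c\<close> into a clique, so a closed
    set contains all or none of those in the two fibres.\<close>
  have all_or_none: "a \<in> X \<longleftrightarrow> b \<in> X"
    if "closed_in ?E (?U' w w') X" "(c, a) \<in> E" "(c, b) \<in> E" "\<phi> a \<in> {w, w'}" "\<phi> b \<in> {w, w'}"
    for a b w w' X
  proof (cases "a = b")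
    case False
    have "a \<in> ?U' w w'" "b \<in> ?U' w w'" using that cc EV by auto
    moreover have "(a, b) \<in> ?E" "(b, a) \<in> ?E" using that False cc s by (auto simp: eliminate_def)
    ultimately show ?thesis using that(1) unfolding closed_in_def by blast
  qed simp
  have closed: "closed_in E (?U w w' - {c}) X" if "closed_in ?E (?U' w w') X" for w w' X
    unfolding closed_in_def
  proof (intro conjI ballI impI)
    show "X \<subseteq> ?U w w' - {c}" using that by (auto simp: closed_in_def)
    fix a b assume ab: "a \<in> X" "b \<in> ?U w w' - {c}" "(a, b) \<in> E"
    then have "a \<noteq> c" "a \<noteq> b" using that \<open>irrefl E\<close> by (auto simp: closed_in_def irrefl_def)
    then have "(a, b) \<in> ?E" using ab by (auto simp: eliminate_def)
    then show "b \<in> X" using that ab unfolding closed_in_def by blast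
  qed
  have out: "sum y X = 0"
    if "closed_in ?E (?U' w w') X" "\<phi> c \<notin> {w, w'}" "w \<in> W" "w' \<in> W" "w \<noteq> w'" for w w' X
  proof -
    have "?U w w' - {c} = ?U w w'" using that by auto
    then have "closed_in E (?U w w') X" using closed[OF that(1)] by simp
    then show ?thesis using modelD2[OF M] that by blast
  qed
  \<comment> \<open>A set meeting the neighbourhood of \<open>c\<close> was closed together with
    \<open>c\<close> before the elimination, so the only error is the lost weight
    \<open>y c\<close>.\<close>
  have inn: "sum y X = y c * of_bool (\<exists>a\<in>X. (c, a) \<in> E)"
    if X: "closed_in ?E (?U' w w') X" "\<phi> c \<in> {w, w'}" "w \<in> W" "w' \<in> W" "w \<noteq> w'" for w w' X
  proof (cases "\<exists>a\<in>X. (c, a) \<in> E")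
    case True
    then obtain a where a: "a \<in> X" "(c, a) \<in> E" by auto
    then have "\<phi> a \<in> {w, w'}" using X by (auto simp: closed_in_def)
    then have "b \<in> X" if "(c, b) \<in> E" "\<phi> b \<in> {w, w'}" for b
      using all_or_none[OF X(1)] a that by blast
    then have "closed_in E (?U w w') (insert c X)"
      using closed[OF X(1)] X(2) \<open>c \<in> V\<close> unfolding closed_in_def by blast
    then have "sum y (insert c X) = 0" using modelD2[OF M] X by blast
    moreover have "c \<notin> X" "finite X" using X(1) \<open>finite V\<close>
      by (auto simp: closed_in_def intro: finite_subset)
    ultimately show ?thesis using True by (simp add: bit_add_eq_0_iff)
  next
    case False
    then have "closed_in E (?U w w') X"
      using closed[OF X(1)] s unfolding closed_in_def by blast
    then show ?thesis using modelD2[OF M] X False by auto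
  qed
  have par: "sum y {a \<in> V - {c}. \<phi> a = w} = \<sigma> + of_bool (\<phi> c = w) * y c" if "w \<in> W" for w
  proof -
    have "\<sigma> = sum y {a \<in> V. \<phi> a = w}" using modelD1[OF M that] by simp
    moreover have "{a \<in> V. \<phi> a = w} = (if \<phi> c = w then insert c {a \<in> V - {c}. \<phi> a = w}
        else {a \<in> V - {c}. \<phi> a = w})" using \<open>c \<in> V\<close> by auto
    ultimately show ?thesis using \<open>finite V\<close> by (simp add: add.commute)
  qed
  consider (A) "\<phi> c \<notin> W \<or> y c = 0"
    | (B) c' where "\<phi> c \<in> W" "y c = 1" "(c, c') \<in> E" "\<phi> c' = \<phi> c"
    | (C) "\<phi> c \<in> W" "y c = 1" "\<And>c'. (c, c') \<in> E \<Longrightarrow> \<phi> c' \<noteq> \<phi> c"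
    by (metis bit_not_zero_iff)
  then show ?thesis
  proof cases
    case A
    have "sum y X = 0" if "closed_in ?E (?U' w w') X" "w \<in> W" "w' \<in> W" "w \<noteq> w'" for w w' X
      using inn[OF that(1) _ that(2-)] out[OF that(1) _ that(2-)] A that by (cases "\<phi> c \<in> {w, w'}") auto
    moreover have "sum y {a \<in> V - {c}. \<phi> a = w} = \<sigma>" if "w \<in> W" for w
      using par[OF that] A that by auto
    ultimately have "model (V - {c}) ?E W \<phi> \<sigma> y" unfolding model_def by blast
    then show ?thesis by blast
  next
    case B
    define y' where "y' = (\<lambda>a. y a + of_bool (a = c'))"
    have c': "c' \<in> V - {c}" using B cc EV by auto
    have sum': "sum y' X = sum y X + of_bool (c' \<in> X)" if "finite X" for X
      using that by (simp add: y'_def sum.distrib sum_of_bool_delta del: sum_of_bool_eq)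
    have "sum y' X = 0" if X: "closed_in ?E (?U' w w') X" "w \<in> W" "w' \<in> W" "w \<noteq> w'" for w w' X
    proof -
      have fin: "finite X" using X(1) \<open>finite V\<close> by (auto simp: closed_in_def intro: finite_subset)
      show ?thesis
      proof (cases "\<phi> c \<in> {w, w'}")
        case True
        have "(\<exists>a\<in>X. (c, a) \<in> E) \<longleftrightarrow> c' \<in> X"
        proof
          assume "\<exists>a\<in>X. (c, a) \<in> E"
          then obtain a where a: "a \<in> X" "(c, a) \<in> E" by auto
          moreover have "\<phi> a \<in> {w, w'}" using a X by (auto simp: closed_in_def)
          ultimately show "c' \<in> X" using all_or_none[OF X(1)] B True by metis
        qed (use B in blast)
        then show ?thesis using inn[OF X(1) True X(2-)] B sum'[OF fin] by simp
      next
        case False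
        then have "c' \<notin> X" using X(1) B by (auto simp: closed_in_def)
        then show ?thesis using out[OF X(1) False X(2-)] sum'[OF fin] by simp
      qed
    qed
    moreover have "sum y' {a \<in> V - {c}. \<phi> a = w} = \<sigma>" if "w \<in> W" for w
    proof -
      have "c' \<in> {a \<in> V - {c}. \<phi> a = w} \<longleftrightarrow> \<phi> c = w" using c' B by auto
      then show ?thesis using par[OF that] sum'[of "{a \<in> V - {c}. \<phi> a = w}"] \<open>finite V\<close> B by simp
    qed
    ultimately have "model (V - {c}) ?E W \<phi> \<sigma> y'" unfolding model_def by blast
    moreover have "\<forall>a. (c, a) \<notin> E \<longrightarrow> y' a = y a" using B by (auto simp: y'_def)
    ultimately show ?thesis by blast
  next
    case C
    \<comment> \<open>Without a neighbour over \<open>w\<close>, the singleton of \<open>c\<close>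
      would be closed in the fibres over \<open>\<phi> c\<close> and \<open>w\<close> although its
      weight is 1.\<close>
    have "\<exists>b. (c, b) \<in> E \<and> \<phi> b = w" if "w \<in> W - {\<phi> c}" for w
    proof (rule ccontr)
      assume "\<not> ?thesis"
      then have "closed_in E (?U (\<phi> c) w) {c}" using C(3) \<open>c \<in> V\<close> by (auto simp: closed_in_def)
      then have "sum y {c} = 0" using modelD2[OF M] C that by blast
      then show False using C by simp
    qed
    then obtain cw where cw: "\<And>w. w \<in> W - {\<phi> c} \<Longrightarrow> (c, cw w) \<in> E"
      "\<And>w. w \<in> W - {\<phi> c} \<Longrightarrow> \<phi> (cw w) = w" by metis
    have cw': "cw w \<in> V - {c}" if "w \<in> W - {\<phi> c}" for w using cw(1)[OF that] EV cc by auto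
    define y' where "y' = (\<lambda>a. y a + of_bool (\<exists>w\<in>W - {\<phi> c}. a = cw w))"
    have "sum y' X = 0" if X: "closed_in ?E (?U' w w') X" "w \<in> W" "w' \<in> W" "w \<noteq> w'" for w w' X
    proof -
      have fin: "finite X" using X(1) \<open>finite V\<close> by (auto simp: closed_in_def intro: finite_subset)
      have phiX: "\<phi> a \<in> {w, w'}" if "a \<in> X" for a using that X(1) by (auto simp: closed_in_def)
      have "y' a = y a + (of_bool (w \<noteq> \<phi> c) * of_bool (a = cw w)
          + of_bool (w' \<noteq> \<phi> c) * of_bool (a = cw w'))" if "a \<in> X" for a
      proof -
        have "(\<exists>v\<in>W - {\<phi> c}. a = cw v) \<longleftrightarrow>
            w \<noteq> \<phi> c \<and> a = cw w \<or> w' \<noteq> \<phi> c \<and> a = cw w'"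
          using phiX[OF that] cw(2) X(2,3) by auto
        moreover have "\<not> (w \<noteq> \<phi> c \<and> a = cw w \<and> w' \<noteq> \<phi> c \<and> a = cw w')"
          using cw(2)[of w] cw(2)[of w'] X(2-4) by auto
        ultimately show ?thesis unfolding y'_def by auto
      qed
      then have "sum y' X = sum y X + (\<Sum>a\<in>X. of_bool (w \<noteq> \<phi> c) * of_bool (a = cw w)
          + of_bool (w' \<noteq> \<phi> c) * of_bool (a = cw w'))"
        by (simp add: sum.distrib)
      also have "(\<Sum>a\<in>X. of_bool (w \<noteq> \<phi> c) * of_bool (a = cw w)
          + of_bool (w' \<noteq> \<phi> c) * of_bool (a = cw w'))
        = of_bool (w \<noteq> \<phi> c \<and> cw w \<in> X) + (of_bool (w' \<noteq> \<phi> c \<and> cw w' \<in> X) :: bit)"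
        using fin by (auto simp: sum.distrib sum_of_bool_delta simp del: sum_of_bool_eq sum_mult_of_bool_eq sum_of_bool_mult_eq simp flip: sum_distrib_left)
      finally have sum': "sum y' X = sum y X +
          (of_bool (w \<noteq> \<phi> c \<and> cw w \<in> X) + of_bool (w' \<noteq> \<phi> c \<and> cw w' \<in> X))" .
      have ex: "(\<exists>a\<in>X. (c, a) \<in> E) \<longleftrightarrow> cw v \<in> X" if "v \<in> W - {\<phi> c}" "v \<in> {w, w'}" for v
      proof
        assume "\<exists>a\<in>X. (c, a) \<in> E"
        then obtain a where a: "a \<in> X" "(c, a) \<in> E" by auto
        then show "cw v \<in> X" using all_or_none[OF X(1) a(2) cw(1)[OF that(1)]] phiX cw(2) that by auto
      qed (use cw that in blast)
      show ?thesis
      proof (cases "\<phi> c \<in> {w, w'}")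
        case True
        then consider "w = \<phi> c" "w' \<in> W - {\<phi> c}" | "w' = \<phi> c" "w \<in> W - {\<phi> c}" using X by auto
        then show ?thesis
          using inn[OF X(1) True X(2-)] C(2) ex unfolding sum' by cases auto
      next
        case False
        then show ?thesis
          using out[OF X(1) False X(2-)] ex[of w] ex[of w'] X unfolding sum' by auto
      qed
    qed
    \<comment> \<open>The fibre of \<open>c\<close> loses the weight of \<open>c\<close>, and every
      other fibre has one weight changed at \<open>cw w\<close>: all parities flip together.\<close>
    moreover have "sum y' {a \<in> V - {c}. \<phi> a = w} = \<sigma> + 1" if "w \<in> W" for w
    proof -
      have "y' a = y a + of_bool (w \<noteq> \<phi> c) * of_bool (a = cw w)" if "\<phi> a = w" for a
        using cw that \<open>w \<in> W\<close> by (auto simp: y'_def)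
      then have "sum y' {a \<in> V - {c}. \<phi> a = w}
          = sum y {a \<in> V - {c}. \<phi> a = w}
            + (\<Sum>a\<in>{a \<in> V - {c}. \<phi> a = w}. of_bool (w \<noteq> \<phi> c) * of_bool (a = cw w))"
        by (simp add: sum.distrib)
      also have "(\<Sum>a\<in>{a \<in> V - {c}. \<phi> a = w}. of_bool (w \<noteq> \<phi> c) * of_bool (a = cw w))
          = (of_bool (w \<noteq> \<phi> c) :: bit)"
        using \<open>finite V\<close> cw'[of w] cw(2)[of w] that
        by (simp add: sum_of_bool_delta del: sum_of_bool_eq sum_mult_of_bool_eq sum_of_bool_mult_eq flip: sum_distrib_left) auto
      finally show ?thesis using par[OF that] C by auto
    qed
    ultimately have "model (V - {c}) ?E W \<phi> (\<sigma> + 1) y'" unfolding model_def by blast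
    moreover have "\<forall>a. (c, a) \<notin> E \<longrightarrow> y' a = y a" using cw by (auto simp: y'_def)
    ultimately show ?thesis by blast
  qed
qed

section \<open>Torsos as iterated eliminations\<close>

inductive path_avoiding :: "('a \<times> 'a) set \<Rightarrow> 'a set \<Rightarrow> 'a \<Rightarrow> 'a \<Rightarrow> bool" for E X where
  edge: "(x, y) \<in> E \<Longrightarrow> path_avoiding E X x y"
| step: "path_avoiding E X x y \<Longrightarrow> y \<notin> X \<Longrightarrow> (y, z) \<in> E \<Longrightarrow> path_avoiding E X x z"

lemma path_avoiding_trans:
  assumes "path_avoiding E X y z" "path_avoiding E X x y" "y \<notin> X"
  shows "path_avoiding E X x z"
  using assms by (induction rule: path_avoiding.induct) (auto intro: path_avoiding.step)

text \<open>The outcome of eliminating all vertices outside \<open>X\<close>, described by walks so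
  that the order of elimination is irrelevant. \<open>torso_arcs_subset\<close> places it inside the
  torso.\<close>

definition torso_arcs :: "('a \<times> 'a) set \<Rightarrow> 'a set \<Rightarrow> ('a \<times> 'a) set" where
  "torso_arcs E X = {(x, y). x \<in> X \<and> y \<in> X \<and> x \<noteq> y \<and> path_avoiding E X x y}"

text \<open>Walks are substituted for arcs; they are joined at vertices outside \<open>X\<close>,
  hence outside \<open>Y\<close>.\<close>

lemma path_avoiding_mono:
  assumes "path_avoiding E X x y" "\<And>a b. (a, b) \<in> E \<Longrightarrow> path_avoiding E' Y a b" "X \<supseteq> Y"
  shows "path_avoiding E' Y x y"
  using assms(1)
proof induction
  case (edge x y)
  then show ?case by (rule assms(2))
next
  case (step x y z)
  then show ?case using assms(2)[OF step(3)] assms(3) path_avoiding_trans[of E' Y y z x] by blast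
qed

lemma path_avoiding_eliminate:
  assumes "path_avoiding (eliminate E c) X x y" "c \<notin> X"
  shows "path_avoiding E X x y"
  using assms(1)
proof (rule path_avoiding_mono)
  fix a b assume "(a, b) \<in> eliminate E c"
  then show "path_avoiding E X a b"
    using assms(2) by (auto simp: eliminate_def intro: path_avoiding.intros)
qed simp

lemma torso_arcs_torso_arcs:
  assumes "Y \<subseteq> X"
  shows "torso_arcs (torso_arcs E X) Y \<subseteq> torso_arcs E Y"
proof -
  have "path_avoiding E Y x y" if "path_avoiding (torso_arcs E X) Y x y" for x y
    using that
  proof (rule path_avoiding_mono)
    fix a b assume "(a, b) \<in> torso_arcs E X"
    then have "path_avoiding E X a b" by (simp add: torso_arcs_def)
    then show "path_avoiding E Y a b"
      by (rule path_avoiding_mono) (use assms in \<open>auto intro: path_avoiding.intros\<close>)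
  qed simp
  then show ?thesis by (auto simp: torso_arcs_def)
qed

lemma path_avoiding_sym:
  assumes "path_avoiding E X x y" "sym E"
  shows "path_avoiding E X y x"
  using assms(1)
proof induction
  case (edge x y)
  then show ?case using assms(2) by (auto intro: path_avoiding.edge dest: symD)
next
  case (step x y z)
  then have "path_avoiding E X z y" using assms(2) by (auto intro: path_avoiding.edge dest: symD)
  then show ?case using step path_avoiding_trans by metis
qed

lemma torso_arcs_sym: "sym E \<Longrightarrow> sym (torso_arcs E X)"
  by (rule symI) (auto simp: torso_arcs_def path_avoiding_sym)

text \<open>Weights change only at neighbours of eliminated vertices. The last clause of the
  conclusion keeps track of this, so that two different eliminations can be compared on a fibre that
  neither of them affects.\<close>

lemma model_torso_arcs:
  assumes "finite V" "sym E" "irrefl E" "E \<subseteq> V \<times> V" "X \<subseteq> V" "model V E W \<phi> \<sigma> y"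
  shows "\<exists>\<sigma>' y'. model X (torso_arcs E X) W \<phi> \<sigma>' y' \<and>
    (\<forall>a. (\<forall>d\<in>V - X. (d, a) \<notin> E) \<longrightarrow> y' a = y a)"
  using assms
proof (induction "card (V - X)" arbitrary: V E \<sigma> y)
  case 0
  then have "V = X" by auto
  moreover have "E \<subseteq> torso_arcs E X"
    using 0 by (auto simp: torso_arcs_def irrefl_def intro: path_avoiding.edge)
  ultimately show ?case using model_mono[OF 0(7)] by blast
next
  case (Suc n)
  then obtain c where c: "c \<in> V" "c \<notin> X" by (metis DiffE card_eq_0_iff ex_in_conv nat.distinct(1))
  obtain \<sigma>1 y1 where 1: "model (V - {c}) (eliminate E c) W \<phi> \<sigma>1 y1"
      "\<And>a. (c, a) \<notin> E \<Longrightarrow> y1 a = y a"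
    using model_eliminate[of V E c W \<phi> \<sigma> y] Suc.prems c by blast
  have "V - X = insert c (V - {c} - X)" using c by auto
  then have "n = card (V - {c} - X)"
    using Suc.hyps(2) Suc.prems(1) by (metis Diff_iff Suc_inject card_insert_disjoint finite_Diff insertCI)
  moreover have "sym (eliminate E c)" "irrefl (eliminate E c)"
      "eliminate E c \<subseteq> (V - {c}) \<times> (V - {c})" "X \<subseteq> V - {c}"
    using Suc.prems c by (auto simp: eliminate_def sym_def irrefl_def)
  ultimately obtain \<sigma>' y' where 2: "model X (torso_arcs (eliminate E c) X) W \<phi> \<sigma>' y'"
      "\<And>a. \<forall>d\<in>V - {c} - X. (d, a) \<notin> eliminate E c \<Longrightarrow> y' a = y1 a"
    using Suc.hyps(1)[of "V - {c}" "eliminate E c" \<sigma>1 y1] 1(1) Suc.prems(1) by blast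
  have "torso_arcs (eliminate E c) X \<subseteq> torso_arcs E X"
    using path_avoiding_eliminate[OF _ c(2)] by (auto simp: torso_arcs_def)
  then have "model X (torso_arcs E X) W \<phi> \<sigma>' y'" using 2(1) model_mono by blast
  \<comment> \<open>New arcs join only neighbours of \<open>c\<close>, so a vertex without
    neighbours outside \<open>X\<close> does not acquire any.\<close>
  moreover have "y' a = y a" if "\<forall>d\<in>V - X. (d, a) \<notin> E" for a
    using that 1(2)[of a] 2(2)[of a] c by (auto simp: eliminate_def)
  ultimately show ?case by blast
qed

text \<open>
  If eliminating the part private to the last bag \<open>B m\<close> destroys the parity, then at a vertex of
  the target outside the image of the adhesion set, this part carries odd weight, and eliminating
  the rest instead preserves the parity.
\<close>

lemma model_in_bag:
  fixes B :: "nat \<Rightarrow> 'a set"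
  assumes "finite V" "sym E" "irrefl E" "V = (\<Union>i\<le>m. B i)" "E \<subseteq> (\<Union>i\<le>m. B i \<times> B i)"
    and "\<And>i. 0 < i \<Longrightarrow> i \<le> m \<Longrightarrow> \<exists>p<i. B i \<inter> (\<Union>j<i. B j) \<subseteq> B p"
    and "\<And>i. 0 < i \<Longrightarrow> i \<le> m \<Longrightarrow> card (B i \<inter> (\<Union>j<i. B j)) < card W"
    and "model V E W \<phi> 1 y"
  shows "\<exists>i\<le>m. \<exists>y'. model (B i) (torso_arcs E (B i)) W \<phi> 1 y'"
  using assms
proof (induction m arbitrary: V E y)
  case 0
  have "E \<subseteq> torso_arcs E (B 0)"
    using "0.prems" by (auto simp: torso_arcs_def irrefl_def intro: path_avoiding.edge)
  then have "model (B 0) (torso_arcs E (B 0)) W \<phi> 1 y"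
    using "0.prems"(4,8) model_mono[of V E W \<phi> 1 y] by simp
  then show ?case by blast
next
  case (Suc m)
  define X where "X = (\<Union>j<Suc m. B j)"
  define Z where "Z = B (Suc m) \<inter> X"
  obtain p where p: "p < Suc m" "Z \<subseteq> B p" using Suc.prems(6)[of "Suc m"] by (auto simp: Z_def X_def)
  have V: "V = X \<union> B (Suc m)" using Suc.prems(4) by (auto simp: X_def atMost_Suc lessThan_Suc_atMost)
  have EV: "E \<subseteq> V \<times> V" using Suc.prems(4,5) by fastforce
  have E: "\<exists>j<Suc m. a \<in> B j \<and> b \<in> B j" if "(a, b) \<in> E" "\<not> (a \<in> B (Suc m) \<and> b \<in> B (Suc m))" for a b
    using that Suc.prems(5) by (fastforce simp: atMost_Suc less_Suc_eq_le)
  have E': "a \<in> B (Suc m) \<and> b \<in> B (Suc m)" if "(a, b) \<in> E" "a \<notin> X \<or> b \<notin> X" for a b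
    using E that by (fastforce simp: X_def)
  have "X \<subseteq> V" "B (Suc m) \<subseteq> V" using V by auto
  obtain \<sigma> y1 where 1: "model X (torso_arcs E X) W \<phi> \<sigma> y1"
      "\<And>a. \<forall>d\<in>V - X. (d, a) \<notin> E \<Longrightarrow> y1 a = y a"
    using model_torso_arcs[OF Suc.prems(1-3) EV \<open>X \<subseteq> V\<close> Suc.prems(8)] by blast
  show ?case
  proof (cases "\<sigma> = 1")
    case True
    \<comment> \<open>A new arc comes from a walk through the private part of the last bag, so both
      its ends lie in the adhesion set \<open>Z\<close> and hence in the bag \<open>B p\<close>: the
      remaining bags still cover all arcs.\<close>
    have "torso_arcs E X \<subseteq> (\<Union>i\<le>m. B i \<times> B i)"
    proof clarify
      fix a b assume ab: "(a, b) \<in> torso_arcs E X"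
      have *: "path_avoiding E X a b \<Longrightarrow> a \<in> X \<Longrightarrow>
        (b \<in> B (Suc m) \<and> a \<in> B (Suc m)) \<or> (\<exists>i\<le>m. a \<in> B i \<and> b \<in> B i)"
      proof (induction rule: path_avoiding.induct)
        case (edge x y)
        then show ?case using E less_Suc_eq_le by blast
      next
        case (step x y z)
        then show ?case using E' by (auto simp: X_def less_Suc_eq_le)
      qed
      then have "(a \<in> Z \<and> b \<in> Z) \<or> (\<exists>i\<le>m. a \<in> B i \<and> b \<in> B i)"
        using ab by (auto simp: torso_arcs_def Z_def)
      then show "(a, b) \<in> (\<Union>i\<le>m. B i \<times> B i)" using p by (auto simp: less_Suc_eq_le)
    qed
    moreover have "sym (torso_arcs E X)" using Suc.prems(2) by (rule torso_arcs_sym)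
    moreover have "irrefl (torso_arcs E X)" by (auto simp: torso_arcs_def irrefl_def)
    moreover have "finite X" using \<open>X \<subseteq> V\<close> Suc.prems(1) finite_subset by blast
    ultimately have "\<exists>i\<le>m. \<exists>y'. model (B i) (torso_arcs (torso_arcs E X) (B i)) W \<phi> 1 y'"
      using Suc.IH[of X "torso_arcs E X" y1] Suc.prems(6,7) 1(1) True
      by (simp add: X_def lessThan_Suc_atMost)
    then obtain i y' where i: "i \<le> m" "model (B i) (torso_arcs (torso_arcs E X) (B i)) W \<phi> 1 y'"
      by blast
    moreover have "B i \<subseteq> X" using i(1) unfolding X_def by (intro UN_upper) simp
    ultimately show ?thesis using model_mono[OF i(2) torso_arcs_torso_arcs] le_Suc_eq by blast
  next
    case False
    then have "\<sigma> = 0" by simp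
    have "finite Z" using \<open>X \<subseteq> V\<close> Suc.prems(1) finite_subset by (auto simp: Z_def)
    then have "card (\<phi> ` Z) < card W"
      using Suc.prems(7)[of "Suc m"] card_image_le[of Z \<phi>] by (simp add: Z_def X_def)
    then obtain w where w: "w \<in> W" "w \<notin> \<phi> ` Z"
      using \<open>finite Z\<close> by (metis card_mono finite_imageI not_less subsetI)
    obtain \<sigma>2 y2 where 2: "model (B (Suc m)) (torso_arcs E (B (Suc m))) W \<phi> \<sigma>2 y2"
        "\<And>a. \<forall>d\<in>V - B (Suc m). (d, a) \<notin> E \<Longrightarrow> y2 a = y a"
      using model_torso_arcs[OF Suc.prems(1-3) EV \<open>B (Suc m) \<subseteq> V\<close> Suc.prems(8)] by blast
    \<comment> \<open>Neither elimination changes a weight over \<open>w\<close>: a kept vertex next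
      to an eliminated one belongs to \<open>Z\<close>, and \<open>Z\<close> has no vertex over
      \<open>w\<close>.\<close>
    have y1: "y1 a = y a" if "a \<in> X" "\<phi> a = w" for a
    proof (rule 1(2), intro ballI notI)
      fix d assume "d \<in> V - X" "(d, a) \<in> E"
      then have "a \<in> Z" using E' that by (auto simp: Z_def)
      then show False using w that by blast
    qed
    have y2: "y2 a = y a" if "a \<in> B (Suc m)" "\<phi> a = w" for a
    proof (rule 2(2), intro ballI notI)
      fix d assume d: "d \<in> V - B (Suc m)" "(d, a) \<in> E"
      then have "a \<in> Z" using E' that by (auto simp: Z_def)
      then show False using w that by blast
    qed
    \<comment> \<open>Missing \<open>Z\<close>, the fibre splits into two disjoint parts. It is odd
      and the part in \<open>X\<close> is even, so the part in the last bag is odd.\<close>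
    have "{a \<in> V. \<phi> a = w} = {a \<in> X. \<phi> a = w} \<union> {a \<in> B (Suc m). \<phi> a = w}" using V by auto
    moreover have "{a \<in> X. \<phi> a = w} \<inter> {a \<in> B (Suc m). \<phi> a = w} = {}" using w by (auto simp: Z_def)
    moreover have "finite X" "finite (B (Suc m))"
      using Suc.prems(1) \<open>X \<subseteq> V\<close> \<open>B (Suc m) \<subseteq> V\<close> finite_subset by auto
    ultimately have "sum y {a \<in> V. \<phi> a = w}
        = sum y {a \<in> X. \<phi> a = w} + sum y {a \<in> B (Suc m). \<phi> a = w}"
      by (simp add: sum.union_disjoint)
    also have "sum y {a \<in> X. \<phi> a = w} = sum y1 {a \<in> X. \<phi> a = w}" using y1 by (intro sum.cong) auto
    also have "sum y {a \<in> B (Suc m). \<phi> a = w} = sum y2 {a \<in> B (Suc m). \<phi> a = w}"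
      using y2 by (intro sum.cong) auto
    finally have "\<sigma>2 = 1"
      using modelD1[OF Suc.prems(8) w(1)] modelD1[OF 1(1) w(1)] modelD1[OF 2(1) w(1)] \<open>\<sigma> = 0\<close> by simp
    then show ?thesis using 2(1) by blast
  qed
qed

subsection \<open>CFI graphs of complete graphs\<close>

lemma of_nat_bit: "(of_nat k :: bit) = of_bool (odd k)"
  by (induction k) auto

lemma odd_card_sym_diff:
  assumes "finite A" "finite B"
  shows "odd (card (sym_diff A B)) \<longleftrightarrow> odd (card A) \<noteq> odd (card B)"
proof -
  have "card A = card (A - B) + card (A \<inter> B)" "card B = card (B - A) + card (A \<inter> B)"
    using assms card_Int_Diff[of A B] card_Int_Diff[of B A] by (simp_all add: Int_commute)
  moreover have "card (sym_diff A B) = card (A - B) + card (B - A)"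
    using assms by (intro card_Un_disjoint) auto
  ultimately show ?thesis by presburger
qed

lemma of_bool_add_mult:
  "(of_bool P + of_bool Q) * x = (if P then x else 0) + (if Q then x else (0::bit))"
  by (cases P; cases Q) simp_all

text \<open>The unknown at \<open>(a, w)\<close> tells whether \<open>w\<close> lies in
  \<open>X a\<close>. If the system is insoluble, the multipliers of the vertex equations are the
  weights of a model: the columns force the even sums, and the right-hand side, supported over 0,
  forces the odd ones.\<close>

lemma cfi_system:
  fixes \<phi> :: "'a \<Rightarrow> nat"
  assumes "finite V" "E \<subseteq> V \<times> V" "\<And>a b. (a, b) \<in> E \<Longrightarrow> \<phi> a \<noteq> \<phi> b" "sym E"
    and \<phi>: "\<And>a. a \<in> V \<Longrightarrow> \<phi> a < n"
    and no: "\<nexists>y. model V E {..<n} \<phi> 1 y"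
  shows "\<exists>X. \<forall>a\<in>V. X a \<subseteq> {..<n} - {\<phi> a} \<and> (odd (card (X a)) \<longleftrightarrow> \<phi> a = 0) \<and>
    (\<forall>b. (a, b) \<in> E \<longrightarrow> (\<phi> b \<in> X a \<longleftrightarrow> \<phi> a \<in> X b))"
proof -
  define J where "J = (SIGMA a:V. {..<n} - {\<phi> a})"
  define I where "I = V <+> E"
  define A :: "'a + 'a \<times> 'a \<Rightarrow> 'a \<times> nat \<Rightarrow> bit" where
    "A = (\<lambda>i j. case i of Inl a \<Rightarrow> of_bool (fst j = a)
      | Inr (a, b) \<Rightarrow> of_bool (j = (a, \<phi> b)) + of_bool (j = (b, \<phi> a)))"
  define r :: "'a + 'a \<times> 'a \<Rightarrow> bit" where
    "r = (\<lambda>i. case i of Inl a \<Rightarrow> of_bool (\<phi> a = 0) | Inr _ \<Rightarrow> 0)"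
  have fin: "finite E" using assms(1,2) finite_subset by blast
  have fJ: "finite J" and fI: "finite I" using assms(1) fin by (auto simp: J_def I_def)
  from bit_system_alternative[OF fJ fI, of A r] show ?thesis
  proof
    assume "\<exists>x. \<forall>i\<in>I. (\<Sum>j\<in>J. A i j * x j) = r i"
    then obtain x where x: "\<And>i. i \<in> I \<Longrightarrow> (\<Sum>j\<in>J. A i j * x j) = r i" by blast
    define X where "X = (\<lambda>a. {w \<in> {..<n} - {\<phi> a}. x (a, w) = 1})"
    have "odd (card (X a)) \<longleftrightarrow> \<phi> a = 0" if "a \<in> V" for a
    proof -
      have "(\<Sum>j\<in>J. A (Inl a) j * x j) = (\<Sum>c\<in>V. \<Sum>w\<in>{..<n} - {\<phi> c}. of_bool (c = a) * x (c, w))"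
        unfolding J_def using assms(1) by (subst sum.Sigma) (auto simp: A_def case_prod_beta)
      also have "\<dots> = (\<Sum>c\<in>V. if c = a then \<Sum>w\<in>{..<n} - {\<phi> c}. x (c, w) else 0)"
        by (intro sum.cong) auto
      also have "\<dots> = (\<Sum>w\<in>{..<n} - {\<phi> a}. x (a, w))" using that assms(1) by simp
      also have "\<dots> = (\<Sum>w\<in>{..<n} - {\<phi> a}. of_bool (x (a, w) = 1))" 
        by (intro sum.cong) auto
      also have "\<dots> = of_bool (odd (card (X a)))"
        by (simp add: X_def of_nat_bit Int_def)
      finally show ?thesis using x[of "Inl a"] that InlI[OF that, of E] by (auto simp: I_def r_def)
    qed
    moreover have "\<phi> b \<in> X a \<longleftrightarrow> \<phi> a \<in> X b" if "(a, b) \<in> E" for a b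
    proof -
      have ab: "a \<in> V" "b \<in> V" "\<phi> a \<noteq> \<phi> b" using that assms by auto
      then have J: "(a, \<phi> b) \<in> J" "(b, \<phi> a) \<in> J" using \<phi> by (auto simp: J_def)
      have "A (Inr (a, b)) j * x j
          = (if j = (a, \<phi> b) then x j else 0) + (if j = (b, \<phi> a) then x j else 0)" for j
        by (simp only: A_def sum.case prod.case of_bool_add_mult)
      then have "(\<Sum>j\<in>J. A (Inr (a, b)) j * x j) = x (a, \<phi> b) + x (b, \<phi> a)"
        using J fJ by (simp add: sum.distrib)
      moreover have "(\<Sum>j\<in>J. A (Inr (a, b)) j * x j) = 0"
        using x[of "Inr (a, b)"] InrI[OF that, of V] by (simp add: I_def r_def)
      ultimately have "x (a, \<phi> b) = x (b, \<phi> a)" by (simp add: bit_add_eq_0_iff)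
      then show ?thesis using ab \<phi> by (auto simp: X_def)
    qed
    moreover have "X a \<subseteq> {..<n} - {\<phi> a}" for a by (auto simp: X_def)
    ultimately show ?thesis by metis
  next
    assume "\<exists>y. (\<forall>j\<in>J. (\<Sum>i\<in>I. y i * A i j) = 0) \<and> (\<Sum>i\<in>I. y i * r i) = 1"
    then obtain y where y: "\<And>j. j \<in> J \<Longrightarrow> (\<Sum>i\<in>I. y i * A i j) = 0" "(\<Sum>i\<in>I. y i * r i) = 1"
      by blast
    define \<eta> where "\<eta> = (\<lambda>a. y (Inl a))"
    \<comment> \<open>An edge contributes the same equation twice, once for each arc; only the sum
      of the two multipliers matters, and it is symmetric.\<close>
    define z where "z = (\<lambda>a b. if (a, b) \<in> E then y (Inr (a, b)) + y (Inr (b, a)) else 0)"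
    have sumI: "(\<Sum>i\<in>I. f i) = (\<Sum>a\<in>V. f (Inl a)) + (\<Sum>e\<in>E. f (Inr e))" for f :: "_ \<Rightarrow> bit"
      unfolding I_def using assms(1) fin by (simp add: sum.Plus)
    \<comment> \<open>Column \<open>(c, w)\<close> of the certificate: the weight of
      \<open>c\<close> is the total of \<open>z\<close> towards each other fibre separately.\<close>
    have \<eta>: "\<eta> c = (\<Sum>d\<in>{d \<in> V. \<phi> d = w}. z c d)" if "c \<in> V" "w < n" "w \<noteq> \<phi> c" for c w
    proof -
      have "0 = (\<Sum>i\<in>I. y i * A i (c, w))" using y(1)[of "(c, w)"] that by (auto simp: J_def)
      also have "\<dots> = (\<Sum>a\<in>V. if a = c then \<eta> a else 0)
          + (\<Sum>(a, b)\<in>E. (if c = a \<and> w = \<phi> b then y (Inr (a, b)) else 0)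
             + (if c = b \<and> w = \<phi> a then y (Inr (a, b)) else 0))"
        unfolding sumI
        by (intro arg_cong2[where f = "(+)"] sum.cong refl)
          (auto simp: A_def \<eta>_def mult.commute[of "y _"] of_bool_add_mult simp del: split_paired_All)
      also have "(\<Sum>a\<in>V. if a = c then \<eta> a else 0) = \<eta> c" using that assms(1) by simp
      also have "(\<Sum>(a, b)\<in>E. (if c = a \<and> w = \<phi> b then y (Inr (a, b)) else 0)
             + (if c = b \<and> w = \<phi> a then y (Inr (a, b)) else 0))
        = (\<Sum>(a, b)\<in>E. (if c = a \<and> w = \<phi> b then y (Inr (a, b)) else 0))
          + (\<Sum>(a, b)\<in>E. (if c = b \<and> w = \<phi> a then y (Inr (a, b)) else 0))"
        by (simp add: sum.distrib case_prod_beta)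
      also have "(\<Sum>(a, b)\<in>E. (if c = b \<and> w = \<phi> a then y (Inr (a, b)) else 0))
        = (\<Sum>(b, a)\<in>E. (if c = b \<and> w = \<phi> a then y (Inr (a, b)) else 0))"
        by (rule sum.reindex_bij_witness[where i = prod.swap and j = prod.swap])
          (use assms(4) in \<open>auto dest: symD\<close>)
      also have "(\<Sum>(a, b)\<in>E. (if c = a \<and> w = \<phi> b then y (Inr (a, b)) else 0)) + \<dots>
        = (\<Sum>(a, b)\<in>E. (if c = a \<and> w = \<phi> b then z a b else 0))"
        unfolding sum.distrib[symmetric] by (intro sum.cong) (auto simp: z_def)
      also have "\<dots> = (\<Sum>e\<in>V \<times> V. (if c = fst e \<and> w = \<phi> (snd e) then z (fst e) (snd e) else 0))"
        using assms(1,2) by (intro sum.mono_neutral_cong_left) (auto simp: z_def)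
      also have "\<dots> = (\<Sum>a\<in>V. \<Sum>b\<in>V. (if c = a \<and> w = \<phi> b then z a b else 0))"
        by (simp add: sum.cartesian_product case_prod_beta)
      also have "\<dots> = (\<Sum>a\<in>V. if a = c then \<Sum>b\<in>V. (if w = \<phi> b then z a b else 0) else 0)"
        by (intro sum.cong) (auto intro!: sum.neutral)
      also have "\<dots> = (\<Sum>b\<in>V. (if w = \<phi> b then z c b else 0))" using that assms(1) by simp
      also have "\<dots> = (\<Sum>d\<in>{d \<in> V. \<phi> d = w}. z c d)"
        using assms(1) by (subst sum.inter_filter[symmetric]) (auto intro!: sum.cong)
      finally show ?thesis by (metis bit_add_eq_0_iff)
    qed
    have closed: "sum \<eta> X = 0"
      if "w < n" "w' < n" "w \<noteq> w'" "closed_in E {a \<in> V. \<phi> a \<in> {w, w'}} X" for w w' X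
    proof -
      have XU: "X \<subseteq> {a \<in> V. \<phi> a \<in> {w, w'}}" using that by (auto simp: closed_in_def)
      have "finite X" using XU assms(1) by (auto intro: finite_subset)
      have "\<eta> a = (\<Sum>d\<in>X. z a d)" if "a \<in> X" for a
      proof -
        define v where "v = (if \<phi> a = w then w' else w)"
        have v: "a \<in> V" "v < n" "v \<noteq> \<phi> a" "v \<in> {w, w'}" "{w, w'} = {v, \<phi> a}"
          using XU that \<open>w < n\<close> \<open>w' < n\<close> \<open>w \<noteq> w'\<close> by (auto simp: v_def)
        have "\<eta> a = (\<Sum>d\<in>{d \<in> V. \<phi> d = v}. z a d)" using \<eta> v by blast
        \<comment> \<open>The set \<open>X\<close> contains all neighbours of \<open>a\<close> in
          the other fibre, and \<open>a\<close> has none in its own.\<close>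
        also have "\<dots> = (\<Sum>d\<in>X. z a d)"
        proof (rule sum.mono_neutral_cong)
          fix d assume d: "d \<in> {d \<in> V. \<phi> d = v} - X"
          then have "(a, d) \<notin> E" using that v \<open>closed_in E _ X\<close> by (auto simp: closed_in_def)
          then show "z a d = 0" by (simp add: z_def)
        next
          fix d assume d: "d \<in> X - {d \<in> V. \<phi> d = v}"
          then have "\<phi> d = \<phi> a" using XU v by blast
          then have "(a, d) \<notin> E" using assms(3) by metis
          then show "z a d = 0" by (simp add: z_def)
        qed (use \<open>finite X\<close> assms(1) in auto)
        finally show ?thesis .
      qed
      then have "sum \<eta> X = (\<Sum>a\<in>X. \<Sum>d\<in>X. z a d)" by simp
      also have "\<dots> = 0" using \<open>finite X\<close> assms(3,4)
        by (intro sum_bit_sym) (auto simp: z_def add.commute dest: symD)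
      finally show ?thesis .
    qed
    have "1 = (\<Sum>a\<in>V. \<eta> a * of_bool (\<phi> a = 0))"
      using y(2) by (simp add: sumI r_def \<eta>_def del: sum_mult_of_bool_eq)
    also have "\<dots> = (\<Sum>a\<in>V. if \<phi> a = 0 then \<eta> a else 0)" by (intro sum.cong) auto
    also have "\<dots> = sum \<eta> {a \<in> V. \<phi> a = 0}" using assms(1) by (simp add: sum.inter_filter)
    finally have one: "sum \<eta> {a \<in> V. \<phi> a = 0} = 1" by simp
    then have "{a \<in> V. \<phi> a = 0} \<noteq> {}" by (metis sum.empty zero_neq_one)
    then have "0 < n" using \<phi> by force
    \<comment> \<open>Oddness spreads from the fibre over 0, because the union of two full fibres is
      closed and therefore even.\<close>
    have "sum \<eta> {a \<in> V. \<phi> a = w} = 1" if "w < n" for w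
    proof (cases "w = 0")
      case False
      have "sum \<eta> {a \<in> V. \<phi> a = w} + sum \<eta> {a \<in> V. \<phi> a = 0}
          = sum \<eta> ({a \<in> V. \<phi> a = w} \<union> {a \<in> V. \<phi> a = 0})"
        using assms(1) False by (intro sum.union_disjoint[symmetric]) auto
      also have "{a \<in> V. \<phi> a = w} \<union> {a \<in> V. \<phi> a = 0} = {a \<in> V. \<phi> a \<in> {w, 0}}" by auto
      also have "sum \<eta> {a \<in> V. \<phi> a \<in> {w, 0}} = 0"
        by (rule closed[of w 0]) (use that False \<open>0 < n\<close> in \<open>auto simp: closed_in_def\<close>)
      finally show ?thesis using one by (simp add: bit_add_eq_0_iff)
    qed (use one in simp)
    then have "model V E {..<n} \<phi> 1 \<eta>" unfolding model_def
      using closed lessThan_iff by blast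
    then have False using no by blast
    then show ?thesis ..
  qed
qed


section \<open>The two CFI graphs and their homomorphism counts\<close>

definition cfi_base :: "nat \<Rightarrow> nat" where
  "cfi_base x = fst (prod_decode x)"

definition cfi_label :: "nat \<Rightarrow> nat set" where
  "cfi_label x = set_decode (snd (prod_decode x))"

definition cfi_code :: "nat \<Rightarrow> nat set \<Rightarrow> nat" where
  "cfi_code v S = prod_encode (v, set_encode S)"

lemma cfi_code_simps [simp]:
  "cfi_base (cfi_code v S) = v" "finite S \<Longrightarrow> cfi_label (cfi_code v S) = S"
  "cfi_code (cfi_base x) (cfi_label x) = x" "finite (cfi_label x)"
  by (simp_all add: cfi_base_def cfi_label_def cfi_code_def)

text \<open>An element \<open>w\<close> of the label stands for the edge from the base vertex to
  \<open>w\<close>. In this variant the edges of the base graph have no vertices of their own: in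
  \<open>cfi\<close>, vertices over different base vertices are adjacent when their labels agree on
  the edge between them. The twist sits at base vertex 0.\<close>

definition cfi_verts :: "nat \<Rightarrow> bool \<Rightarrow> nat set" where
  "cfi_verts n t = {x. cfi_base x < n \<and> cfi_label x \<subseteq> {..<n} - {cfi_base x} \<and>
     (odd (card (cfi_label x)) \<longleftrightarrow> t \<and> cfi_base x = 0)}"

definition cfi :: "nat \<Rightarrow> bool \<Rightarrow> nat pair_pre_digraph" where
  "cfi n t = \<lparr>pverts = cfi_verts n t, parcs = {(x, y). x \<in> cfi_verts n t \<and> y \<in> cfi_verts n t \<and>
     cfi_base x \<noteq> cfi_base y \<and> (cfi_base y \<in> cfi_label x \<longleftrightarrow> cfi_base x \<in> cfi_label y)}\<rparr>"

lemma finite_cfi_verts: "finite (cfi_verts n t)"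
proof (rule finite_subset)
  show "cfi_verts n t \<subseteq> case_prod cfi_code ` ({..<n} \<times> Pow {..<n})"
  proof
    fix x assume "x \<in> cfi_verts n t"
    then have "(cfi_base x, cfi_label x) \<in> {..<n} \<times> Pow {..<n}" by (auto simp: cfi_verts_def)
    then show "x \<in> case_prod cfi_code ` ({..<n} \<times> Pow {..<n})"
      by (metis (no_types, lifting) cfi_code_simps(3) case_prod_conv image_eqI)
  qed
qed simp

lemma pair_graph_cfi: "pair_graph (cfi n t)"
proof -
  have "finite (parcs (cfi n t))"
    by (rule finite_subset[OF _ finite_cartesian_product[OF finite_cfi_verts finite_cfi_verts]])
      (auto simp: cfi_def)
  moreover have "symmetric (with_proj (cfi n t))"
    by (auto simp: symmetric_def cfi_def intro!: symI)
  ultimately show ?thesis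
    using finite_cfi_verts[of n t] by unfold_locales (auto simp: cfi_def)
qed

text \<open>Adding a solution of the twisted system to the labels exchanges the homomorphisms to the
  two graphs and keeps their projection to the base graph.\<close>

lemma hom_count_cfi_eq:
  assumes F: "pair_graph F" and no: "\<nexists>\<phi> y. model (pverts F) (parcs F) {..<n} \<phi> 1 y"
  shows "hom_count F (cfi n False) = hom_count F (cfi n True)"
proof -
  interpret F: pair_graph F by fact
  let ?V = "pverts F" and ?E = "parcs F"
  have EV: "?E \<subseteq> ?V \<times> ?V" using F.in_arcsD1 F.in_arcsD2 by auto
  have symE: "sym ?E" using F.arcs_symmetric by (auto intro: symI)
  define sol where "sol = (\<lambda>\<phi> X. \<forall>a\<in>?V. X a \<subseteq> {..<n} - {\<phi> a} \<and> (odd (card (X a)) \<longleftrightarrow> \<phi> a = 0) \<and>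
    (\<forall>b. (a, b) \<in> ?E \<longrightarrow> (\<phi> b \<in> X a \<longleftrightarrow> \<phi> a \<in> X b)))"
  define proj where "proj = (\<lambda>h. restrict (cfi_base \<circ> h) ?V)"
  \<comment> \<open>The solution depends on the projection alone, which \<open>\<tau>\<close>
    preserves; this makes \<open>\<tau>\<close> an involution.\<close>
  define X where "X = (\<lambda>\<phi>. SOME X. sol \<phi> X)"
  define \<tau> where "\<tau> = (\<lambda>h. \<lambda>a\<in>?V. cfi_code (cfi_base (h a)) (sym_diff (cfi_label (h a)) (X (proj h) a)))"
  have hE: "(h a, h b) \<in> parcs (cfi n t)" if "h \<in> homs F (cfi n t)" "(a, b) \<in> ?E" for h t a b
    using that by (auto simp: homs_def)
  have hV: "h a \<in> cfi_verts n t" if "h \<in> homs F (cfi n t)" "a \<in> ?V" for h t a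
    using that by (auto simp: homs_def cfi_def)
  have sol: "sol (proj h) (X (proj h))" if "h \<in> homs F (cfi n t)" for h t
  proof -
    have "proj h a \<noteq> proj h b" if "(a, b) \<in> ?E" for a b
      using hE[OF \<open>h \<in> _\<close> that] EV that by (auto simp: proj_def cfi_def)
    moreover have "proj h a < n" if "a \<in> ?V" for a
      using hV[OF \<open>h \<in> _\<close> that] that by (simp add: proj_def cfi_verts_def)
    moreover have "\<nexists>y. model ?V ?E {..<n} (proj h) 1 y" using no by blast
    ultimately have "\<exists>Y. sol (proj h) Y"
      unfolding sol_def by (intro cfi_system[OF F.pair_finite_verts EV _ symE])
    then show ?thesis unfolding X_def by (rule someI_ex)
  qed
  have X: "X (proj h) a \<subseteq> {..<n} - {cfi_base (h a)}" "odd (card (X (proj h) a)) \<longleftrightarrow> cfi_base (h a) = 0"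
      "finite (X (proj h) a)"
    if "h \<in> homs F (cfi n t)" "a \<in> ?V" for h t a
    using sol[OF that(1)] that(2) by (auto simp: sol_def proj_def intro: finite_subset)
  have XE: "cfi_base (h b) \<in> X (proj h) a \<longleftrightarrow> cfi_base (h a) \<in> X (proj h) b"
    if "h \<in> homs F (cfi n t)" "(a, b) \<in> ?E" for h t a b
  proof -
    have "a \<in> ?V" "b \<in> ?V" using that EV by auto
    moreover from this have "proj h b \<in> X (proj h) a \<longleftrightarrow> proj h a \<in> X (proj h) b"
      using sol[OF that(1)] that(2) unfolding sol_def by blast
    moreover have "proj h c = cfi_base (h c)" if "c \<in> ?V" for c using that by (simp add: proj_def)
    ultimately show ?thesis by simp
  qed
  have base: "cfi_base (\<tau> h a) = cfi_base (h a)" if "a \<in> ?V" for h a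
    using that by (simp add: \<tau>_def)
  have label: "cfi_label (\<tau> h a) = sym_diff (cfi_label (h a)) (X (proj h) a)"
    if "h \<in> homs F (cfi n t)" "a \<in> ?V" for h t a
    using that X(3)[OF that] by (simp add: \<tau>_def)
  have mem: "\<tau> h \<in> homs F (cfi n (\<not> t))" if h: "h \<in> homs F (cfi n t)" for h t
  proof -
    have v: "\<tau> h a \<in> cfi_verts n (\<not> t)" if a: "a \<in> ?V" for a
      using hV[OF h a] X[OF h a] odd_card_sym_diff[of "cfi_label (h a)" "X (proj h) a"]
      by (auto simp: cfi_verts_def base[OF a] label[OF h a])
    have "(\<tau> h a, \<tau> h b) \<in> parcs (cfi n (\<not> t))" if e: "(a, b) \<in> ?E" for a b
    proof -
      have ab: "a \<in> ?V" "b \<in> ?V" using e EV by auto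
      show ?thesis
        using hE[OF h e] v[OF ab(1)] v[OF ab(2)] XE[OF h e]
        by (auto simp: cfi_def base[OF ab(1)] base[OF ab(2)] label[OF h ab(1)] label[OF h ab(2)])
    qed
    moreover have "\<tau> h \<in> ?V \<rightarrow>\<^sub>E pverts (cfi n (\<not> t))" using v by (auto simp: \<tau>_def cfi_def)
    ultimately show ?thesis by (auto simp: homs_def)
  qed
  have inv: "\<tau> (\<tau> h) = h" if h: "h \<in> homs F (cfi n t)" for h t
  proof
    fix a
    have p: "proj (\<tau> h) = proj h" using base by (auto simp: proj_def)
    show "\<tau> (\<tau> h) a = h a"
    proof (cases "a \<in> ?V")
      case True
      have "sym_diff (sym_diff A B) B = A" for A B :: "nat set" by auto
      then have "cfi_label (\<tau> (\<tau> h) a) = cfi_label (h a)" "cfi_base (\<tau> (\<tau> h) a) = cfi_base (h a)"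
        using label[OF mem[OF h] True] label[OF h True] base[OF True] by (simp_all add: p)
      then show ?thesis by (metis cfi_code_simps(3))
    next
      case False
      then show ?thesis using h by (auto simp: \<tau>_def homs_def PiE_def extensional_def)
    qed
  qed
  have "bij_betw \<tau> (homs F (cfi n False)) (homs F (cfi n True))"
    by (rule bij_betw_byWitness[where f' = \<tau>]) (use inv mem[of _ True] mem[of _ False] in auto)
  then show ?thesis unfolding hom_count_def by (rule bij_betw_same_card)
qed

text \<open>The empty labels form a clique of size \<open>n\<close> in the untwisted graph. Its
  image would consist of vertices over all \<open>n\<close> base vertices, exactly one of them with
  an odd label; as adjacent labels agree, counting the label elements modulo 2 gives both 0 and
  1.\<close>

lemma cfi_not_isomorphic:
  assumes "1 < n"
  shows "\<not> isomorphic (cfi n False) (cfi n True)"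
proof
  assume "isomorphic (cfi n False) (cfi n True)"
  then obtain g where g: "pre_digraph.digraph_isomorphism (with_proj (cfi n False)) g"
    "with_proj (cfi n True) = app_iso g (with_proj (cfi n False))"
    by (auto simp: isomorphic_def digraph_iso_def)
  interpret G: pair_graph "cfi n False" by (rule pair_graph_cfi)
  from wf_digraph.arcs_ends_app_iso_eq[OF G.wf_digraph_axioms g(1), folded g(2)]
  have arcs: "parcs (cfi n True) = (\<lambda>(u, v). (iso_verts g u, iso_verts g v)) ` parcs (cfi n False)"
    by (simp only: with_proj_simps)
  define f where "f = (\<lambda>i. iso_verts g (cfi_code i {}))"
  have f: "(f i, f j) \<in> parcs (cfi n True)" if "i < n" "j < n" "i \<noteq> j" for i j
  proof -
    have "(cfi_code i {}, cfi_code j {}) \<in> parcs (cfi n False)"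
      using that by (simp add: cfi_def cfi_verts_def)
    then show ?thesis unfolding arcs f_def by force
  qed
  show False
  proof -
    have fV: "f i \<in> cfi_verts n True" if "i < n" for i
    proof -
      obtain j where "j < n" "j \<noteq> i" using assms by (metis less_trans zero_less_one zero_neq_one)
      then show ?thesis using f[of i j] that by (auto simp: cfi_def)
    qed
    define p where "p = (\<lambda>i. cfi_base (f i))"
    have "inj_on p {..<n}" using f by (auto simp: inj_on_def p_def cfi_def)
    moreover have "p ` {..<n} \<subseteq> {..<n}" using fV by (auto simp: p_def cfi_verts_def)
    ultimately have bij: "bij_betw p {..<n} {..<n}"
      by (metis bij_betw_def card_image card_subset_eq finite_lessThan)
    have "(\<Sum>i<n. \<Sum>j<n. of_bool (p j \<in> cfi_label (f i)) :: bit) = 0"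
    proof (rule sum_bit_sym)
      fix i j assume "i \<in> {..<n}" "j \<in> {..<n}"
      then show "(of_bool (p j \<in> cfi_label (f i)) :: bit) = of_bool (p i \<in> cfi_label (f j))"
        using f[of i j] by (cases "i = j") (auto simp: p_def cfi_def)
    next
      fix i assume "i \<in> {..<n}"
      then show "(of_bool (p i \<in> cfi_label (f i)) :: bit) = 0"
        using fV[of i] by (auto simp: p_def cfi_verts_def)
    qed simp
    moreover have "(\<Sum>j<n. of_bool (p j \<in> cfi_label (f i)) :: bit) = of_bool (p i = 0)" if "i < n" for i
    proof -
      have "(\<Sum>j<n. of_bool (p j \<in> cfi_label (f i)) :: bit) = (\<Sum>v<n. of_bool (v \<in> cfi_label (f i)))"
        by (rule sum.reindex_bij_betw[OF bij])
      also have "\<dots> = of_nat (card ({..<n} \<inter> cfi_label (f i)))" by simp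
      also have "{..<n} \<inter> cfi_label (f i) = cfi_label (f i)"
        using fV[OF that] by (auto simp: cfi_verts_def)
      finally show ?thesis using fV[OF that] by (simp add: of_nat_bit cfi_verts_def p_def)
    qed
    moreover have "(\<Sum>i<n. of_bool (p i = 0) :: bit) = (\<Sum>v<n. of_bool (v = 0))"
      by (rule sum.reindex_bij_betw[OF bij])
    moreover have "(\<Sum>v<n. of_bool (v = 0) :: bit) = 1"
      using assms by (simp add: sum_of_bool_delta del: sum_of_bool_eq)
    ultimately show False by (simp del: sum_of_bool_eq)
  qed
qed

subsection \<open>Tree decompositions\<close>

lemma pair_graph_sym: "pair_graph G \<Longrightarrow> sym (parcs G)"
  by (auto intro: symI dest: pair_sym_digraph.arcs_symmetric[OF pair_pseudo_graph.axioms(2)[OF pair_graph.axioms(2)]])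

lemma pair_graph_irrefl: "pair_graph G \<Longrightarrow> irrefl (parcs G)"
  by (auto simp: irrefl_def dest: pair_loopfree_digraph.pair_no_loops[OF pair_digraph.axioms(2)[OF pair_graph.axioms(1)]])

lemma pair_graph_arcs:
  assumes "pair_graph G" shows "parcs G \<subseteq> pverts G \<times> pverts G"
proof -
  interpret pair_graph G by fact
  show ?thesis using in_arcsD1 in_arcsD2 by auto
qed

lemma pair_graph_finite: "pair_graph G \<Longrightarrow> finite (pverts G)"
  by (rule pair_fin_digraph.pair_finite_verts[OF pair_digraph.axioms(1)[OF pair_graph.axioms(1)]])

lemma finite_nbrs:
  assumes "pair_graph G" shows "finite (nbrs G v)"
  by (rule finite_subset[OF _ pair_graph_finite[OF assms]])
    (use pair_graph_arcs[OF assms] in \<open>auto simp: nbrs_def\<close>)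

lemma components_eq:
  assumes "pair_graph G"
  shows "components G = (\<lambda>u. {v \<in> pverts G. (u, v) \<in> (parcs G)\<^sup>*}) ` pverts G"
proof -
  interpret pair_graph G by fact
  have "scc_of u = {v \<in> pverts G. (u, v) \<in> (parcs G)\<^sup>*}" if "u \<in> pverts G" for u
    using that sym_rtrancl[OF pair_graph_sym[OF assms]]
    by (auto simp: scc_of_def reachable_conv dest: symD)
  then show ?thesis unfolding components_def sccs_verts_conv_scc_of by (intro image_cong) auto
qed

lemma connected_rtrancl:
  assumes "pair_graph G" "connected (with_proj G)" "u \<in> pverts G" "v \<in> pverts G"
  shows "(u, v) \<in> (parcs G)\<^sup>*"
proof -
  interpret pair_graph G by fact
  show ?thesis
    using assms(2-4) reachable_mk_symmetric_eq[OF pair_sym_arcs, of u v]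
    unfolding connected_def strongly_connected_def by (auto simp: reachable_conv)
qed

lemma pawalk_verts_snoc:
  "pcas u p t \<Longrightarrow> pawalk_verts u (p @ [(t, x)]) = pawalk_verts u p @ [x]"
  by (induction p arbitrary: u) auto

text \<open>Every edge of a tree is a bridge: a simple path around it has at least two arcs, so
  closing it up gives a cycle of the forbidden length.\<close>

lemma tree_no_detour:
  assumes T: "tree_graph T" and st: "(s, t) \<in> parcs T"
  shows "(s, t) \<notin> (parcs T - {(s, t), (t, s)})\<^sup>*"
proof
  assume path: "(s, t) \<in> (parcs T - {(s, t), (t, s)})\<^sup>*"
  interpret T: pair_graph T using T by (simp add: tree_graph_def)
  define T' where "T' = \<lparr>pverts = pverts T, parcs = parcs T - {(s, t), (t, s)}\<rparr>"
  interpret T': pair_wf_digraph T'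
    by unfold_locales (auto simp: T'_def dest: T.in_arcsD1 T.in_arcsD2)
  have "s \<rightarrow>\<^sup>*\<^bsub>with_proj T'\<^esub> t"
  proof -
    have "(s, t) \<in> (parcs T')\<^sup>*" "s \<in> pverts T'" "t \<in> pverts T'"
      using path T.in_arcsD1[OF st] T.in_arcsD2[OF st] by (simp_all add: T'_def)
    then show ?thesis by (simp add: T'.reachable_conv)
  qed
  then obtain p where p: "T'.apath s p t" using T'.reachable_apath by blast
  then have p': "set p \<subseteq> parcs T'" "pcas s p t" "distinct (pawalk_verts s p)"
    by (auto simp: T'.apath_def T'.awalk_def)
  have "s \<noteq> t" using st T.no_loops' by blast
  have "length p \<ge> 2"
  proof (rule ccontr)
    assume "\<not> ?thesis"
    then consider "p = []" | e where "p = [e]" by (cases p; cases "tl p") auto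
    then show False using p' \<open>s \<noteq> t\<close> by cases (auto simp: T'_def)
  qed
  have verts: "pawalk_verts s (p @ [(t, s)]) = pawalk_verts s p @ [s]"
    by (rule pawalk_verts_snoc) fact
  obtain vs where vs: "pawalk_verts s p = s # vs"
    using p'(2) by (cases p) auto
  have "T.awalk s p t" using p' T.in_arcsD1[OF st] by (auto simp: T.awalk_def T'_def)
  then have "T.awalk s (p @ [(t, s)]) s"
    using T.arcs_symmetric[OF st] T.in_arcsD1[OF st] by (simp add: T.awalk_simps)
  moreover have "distinct (tl (pawalk_verts s (p @ [(t, s)])))"
    using p'(3) by (simp add: verts vs)
  ultimately have "T.cycle (p @ [(t, s)])" unfolding T.cycle_def by blast
  moreover have "length (p @ [(t, s)]) \<ge> 3" using \<open>length p \<ge> 2\<close> by simp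
  ultimately show False using T unfolding tree_graph_def by blast
qed

lemma rtrancl_leaves:
  assumes "(a, b) \<in> r\<^sup>*" "a \<in> A" "b \<notin> A"
  shows "\<exists>x y. (x, y) \<in> r \<and> x \<in> A \<and> y \<notin> A"
  using assms by (induction rule: rtrancl_induct) auto

text \<open>As long as nodes are missing, connectedness supplies an edge leaving the set of those
  listed, and its far end comes next. The list has \<open>n + 1\<close> entries, hence the strict
  bound.\<close>

lemma tree_enumeration:
  assumes "pair_graph T" "connected (with_proj T)" "n < card (pverts T)"
  shows "\<exists>f. inj_on f {..n} \<and> f ` {..n} \<subseteq> pverts T \<and>
    (\<forall>i. 0 < i \<and> i \<le> n \<longrightarrow> (\<exists>p<i. (f p, f i) \<in> parcs T))"
  using assms(3)
proof (induction n)
  case 0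
  then obtain t where "t \<in> pverts T" by fastforce
  then show ?case by (intro exI[of _ "\<lambda>_. t"]) auto
next
  case (Suc n)
  then obtain f where f: "inj_on f {..n}" "f ` {..n} \<subseteq> pverts T"
    "\<And>i. 0 < i \<Longrightarrow> i \<le> n \<Longrightarrow> \<exists>p<i. (f p, f i) \<in> parcs T" by auto
  have "card (f ` {..n}) < card (pverts T)" using Suc.prems f(1) by (simp add: card_image)
  then obtain t where t: "t \<in> pverts T" "t \<notin> f ` {..n}"
    by (metis card_mono finite_atMost finite_imageI not_less subsetI)
  have "f 0 \<in> f ` {..n}" by simp
  then have "(f 0, t) \<in> (parcs T)\<^sup>*" using connected_rtrancl[OF assms(1,2)] f(2) t(1) by blast
  from rtrancl_leaves[OF this \<open>f 0 \<in> f ` {..n}\<close> t(2)]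
  obtain p y where y: "p \<le> n" "(f p, y) \<in> parcs T" "y \<notin> f ` {..n}" by auto
  define g where "g = f(Suc n := y)"
  have g: "g i = f i" if "i \<le> n" for i using that by (simp add: g_def)
  have "inj_on g {..Suc n}"
    using f(1) y(3) unfolding atMost_Suc by (auto simp: g_def inj_on_def)
  moreover have "g ` {..Suc n} \<subseteq> pverts T"
    using f(2) y(2) pair_graph_arcs[OF assms(1)] by (auto simp: g_def atMost_Suc)
  moreover have "\<exists>p<i. (g p, g i) \<in> parcs T" if i: "0 < i" "i \<le> Suc n" for i
  proof (cases "i = Suc n")
    case True
    then show ?thesis using y by (intro exI[of _ p]) (auto simp: g_def)
  next
    case False
    then have "i \<le> n" using i by simp
    then obtain q where "q < i" "(f q, f i) \<in> parcs T" using f(3)[of i] i(1) by blast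
    then show ?thesis using g \<open>i \<le> n\<close> by (intro exI[of _ q]) simp
  qed
  ultimately show ?case by blast
qed

text \<open>The running intersection property. If \<open>v\<close> lay in bag \<open>i\<close> and
  in an earlier bag but not in the parent bag, the nodes holding \<open>v\<close> would join
  \<open>f i\<close> to an earlier node without the edge to the parent, and the earlier nodes would
  complete a detour around this edge.\<close>

lemma tree_decomposition_bags:
  assumes td: "tree_decomposition G T \<beta>"
  obtains f :: "nat \<Rightarrow> 't" and m where "f ` {..m} = pverts T"
    "\<And>i. 0 < i \<Longrightarrow> i \<le> m \<Longrightarrow> \<exists>p<i. (f p, f i) \<in> parcs T \<and> \<beta> (f i) \<inter> (\<Union>j<i. \<beta> (f j)) \<subseteq> \<beta> (f p)"
proof -
  have tree: "tree_graph T" using td by (simp add: tree_decomposition_def)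
  then have T: "pair_graph T" and conn: "connected (with_proj T)" by (auto simp: tree_graph_def)
  have "pverts T \<noteq> {}" using conn by (auto simp: connected_def strongly_connected_def)
  then have "card (pverts T) > 0" using pair_graph_finite[OF T] by (simp add: card_gt_0_iff)
  then obtain m where m: "card (pverts T) = Suc m" by (cases "card (pverts T)") auto
  then obtain f where f: "inj_on f {..m}" "f ` {..m} \<subseteq> pverts T"
    "\<And>i. 0 < i \<Longrightarrow> i \<le> m \<Longrightarrow> \<exists>p<i. (f p, f i) \<in> parcs T"
    using tree_enumeration[OF T conn, of m] by auto
  have all: "f ` {..m} = pverts T"
    using f(1,2) m pair_graph_finite[OF T] by (intro card_subset_eq) (auto simp: card_image)
  have sym: "sym (parcs T)" by (rule pair_graph_sym[OF T])
  \<comment> \<open>The tree edges among the nodes listed before \<open>f i\<close>; none of them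
    touches \<open>f i\<close>.\<close>
  define R where "R = (\<lambda>i. parcs T \<inter> (f ` {..<i}) \<times> (f ` {..<i}))"
  have symR: "sym (R i)" for i using sym by (auto simp: R_def sym_def)
  have root: "(f 0, f j) \<in> (R i)\<^sup>*" if "j < i" "i \<le> Suc m" for i j
    using that(1)
  proof (induction j rule: less_induct)
    case (less j)
    show ?case
    proof (cases "j = 0")
      case False
      moreover have "j \<le> m" using less.prems that(2) by simp
      ultimately obtain p where p: "p < j" "(f p, f j) \<in> parcs T" using f(3)[of j] by auto
      then have "(f 0, f p) \<in> (R i)\<^sup>*" using less by simp
      moreover have "(f p, f j) \<in> R i" using p less.prems by (auto simp: R_def)
      ultimately show ?thesis by (rule rtrancl_into_rtrancl)
    qed simp
  qed
  have "\<exists>p<i. (f p, f i) \<in> parcs T \<and> \<beta> (f i) \<inter> (\<Union>j<i. \<beta> (f j)) \<subseteq> \<beta> (f p)" if i: "0 < i" "i \<le> m" for i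
  proof -
    obtain p where p: "p < i" "(f p, f i) \<in> parcs T" using f(3)[OF i] by blast
    have "v \<in> \<beta> (f p)" if v: "v \<in> \<beta> (f i)" "v \<in> \<beta> (f j)" "j < i" for v j
    proof (rule ccontr)
      assume np: "v \<notin> \<beta> (f p)"
      let ?E = "parcs T - {(f p, f i), (f i, f p)}"
      have "f i \<noteq> f j" if "j < i" for j using inj_onD[OF f(1), of i j] i that by auto
      then have "f i \<notin> f ` {..<i}" by blast
      then have "R i \<subseteq> ?E" unfolding R_def by blast
      then have RE: "(R i)\<^sup>* \<subseteq> ?E\<^sup>*" by (rule rtrancl_mono)
      have "(f 0, f p) \<in> (R i)\<^sup>*" "(f 0, f j) \<in> (R i)\<^sup>*" using root p(1) v(3) i by auto
      then have "(f p, f j) \<in> (R i)\<^sup>*" using symD[OF sym_rtrancl[OF symR]] rtrancl_trans by metis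
      define S where "S = {t \<in> pverts T. v \<in> \<beta> t}"
      have inT: "f i \<in> pverts T" "f j \<in> pverts T" using all i v(3) by auto
      have "v \<in> pverts G" using td v(1) inT by (auto simp: tree_decomposition_def)
      then have "connected (with_proj (induced T S))" using td by (simp add: tree_decomposition_def S_def)
      moreover have "pverts (induced T S) = S" by (auto simp: induced_def S_def)
      ultimately have "(f j, f i) \<in> (parcs (induced T S))\<^sup>*"
        using connected_rtrancl[OF pair_graph_induced[OF T]] inT v by (auto simp: S_def)
      moreover have "parcs (induced T S) \<subseteq> ?E" using np by (auto simp: induced_def S_def)
      ultimately have "(f j, f i) \<in> ?E\<^sup>*" using rtrancl_mono by blast
      moreover have "(f p, f j) \<in> ?E\<^sup>*" using RE \<open>(f p, f j) \<in> (R i)\<^sup>*\<close> by blast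
      ultimately have "(f p, f i) \<in> ?E\<^sup>*" by (rule rtrancl_trans[rotated])
      then show False using tree_no_detour[OF tree p(2)] by blast
    qed
    then show ?thesis using p by blast
  qed
  then show thesis using that all by blast
qed

text \<open>The interior of a walk avoiding \<open>X\<close> stays in one component of the rest, and
  both ends are adjacent to that component.\<close>

lemma torso_arcs_subset:
  assumes "pair_graph G" "X \<subseteq> pverts G"
  shows "torso_arcs (parcs G) X \<subseteq> parcs (torso G X)"
proof clarify
  fix x y assume xy: "(x, y) \<in> torso_arcs (parcs G) X"
  let ?R = "remove_verts G X"
  have R: "pair_graph ?R" unfolding remove_verts_def by (rule pair_graph_induced) fact
  have Rv: "pverts ?R = pverts G - X" by (auto simp: remove_verts_def induced_def)
  note EV = pair_graph_arcs[OF assms(1)]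
  have *: "(x, y) \<in> parcs G \<or>
      (\<exists>c d. (x, c) \<in> parcs G \<and> (c, d) \<in> (parcs ?R)\<^sup>* \<and> c \<notin> X \<and> d \<notin> X \<and> (d, y) \<in> parcs G)"
    if "path_avoiding (parcs G) X x y" "x \<in> X" for x y
    using that
  proof (induction rule: path_avoiding.induct)
    case (step x y z)
    then have "y \<notin> X" "(y, z) \<in> parcs G" by auto
    from step.IH[OF step.prems] show ?case
    proof
      assume "(x, y) \<in> parcs G"
      then show ?case using step by blast
    next
      assume "\<exists>c d. (x, c) \<in> parcs G \<and> (c, d) \<in> (parcs ?R)\<^sup>* \<and> c \<notin> X \<and> d \<notin> X \<and> (d, y) \<in> parcs G"
      then obtain c d where cd: "(x, c) \<in> parcs G" "(c, d) \<in> (parcs ?R)\<^sup>*" "c \<notin> X" "d \<notin> X" "(d, y) \<in> parcs G"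
        by blast
      then have "(d, y) \<in> parcs ?R" using \<open>y \<notin> X\<close> EV by (auto simp: remove_verts_def induced_def)
      then have "(c, y) \<in> (parcs ?R)\<^sup>*" using cd(2) by (rule rtrancl_into_rtrancl[rotated])
      then show ?case using cd(1,3) step by blast
    qed
  qed auto
  have X: "x \<in> X" "y \<in> X" "x \<noteq> y" using xy by (auto simp: torso_arcs_def)
  from *[of x y] xy X show "(x, y) \<in> parcs (torso G X)"
  proof (cases "(x, y) \<in> parcs G")
    case False
    then obtain c d where cd: "(x, c) \<in> parcs G" "(c, d) \<in> (parcs ?R)\<^sup>*" "c \<notin> X" "d \<notin> X" "(d, y) \<in> parcs G"
      using *[of x y] xy by (auto simp: torso_arcs_def)
    define C where "C = {v \<in> pverts ?R. (c, v) \<in> (parcs ?R)\<^sup>*}"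
    have "c \<in> pverts ?R" "d \<in> pverts ?R" using cd EV by (auto simp: Rv)
    then have C: "C \<in> components ?R" "c \<in> C" "d \<in> C"
      unfolding components_eq[OF R] using cd by (auto simp: C_def)
    have "x \<notin> C" "y \<notin> C" using X by (auto simp: C_def Rv)
    then have "x \<in> set_nbrs G C" "y \<in> set_nbrs G C"
      using C cd symD[OF pair_graph_sym[OF assms(1)] cd(1)] by (auto simp: set_nbrs_def)
    then show ?thesis using X C(1) by (auto simp: torso_def)
  qed (auto simp: torso_def)
qed

lemma sum_class_model:
  assumes F: "F \<in> sum_class \<C> s" and M: "model (pverts F) (parcs F) W \<phi> 1 y" and "s < card W"
  obtains X y' where "torso F X \<in> \<C>" "model X (parcs (torso F X)) W \<phi> 1 y'"
proof -
  obtain T :: "nat pair_pre_digraph" and \<beta> where td: "tree_decomposition F T \<beta>"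
    and adh: "\<And>t t'. (t, t') \<in> parcs T \<Longrightarrow> card (\<beta> t \<inter> \<beta> t') \<le> s"
    and tor: "\<And>t. t \<in> pverts T \<Longrightarrow> torso F (\<beta> t) \<in> \<C>"
    using F unfolding sum_class_def by blast
  have pg: "pair_graph F" using F by (simp add: sum_class_def)
  obtain f and m :: nat where f: "f ` {..m} = pverts T"
    "\<And>i. 0 < i \<Longrightarrow> i \<le> m \<Longrightarrow> \<exists>p<i. (f p, f i) \<in> parcs T \<and> \<beta> (f i) \<inter> (\<Union>j<i. \<beta> (f j)) \<subseteq> \<beta> (f p)"
    using tree_decomposition_bags[OF td] by blast
  have "(\<Union>i\<le>m. \<beta> (f i)) = (\<Union>t\<in>f ` {..m}. \<beta> t)" by simp
  then have V: "pverts F = (\<Union>i\<le>m. \<beta> (f i))" using td f(1) by (simp add: tree_decomposition_def)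
  have E: "parcs F \<subseteq> (\<Union>i\<le>m. \<beta> (f i) \<times> \<beta> (f i))"
  proof clarify
    fix u v assume "(u, v) \<in> parcs F"
    then obtain t where "t \<in> f ` {..m}" "u \<in> \<beta> t" "v \<in> \<beta> t"
      using td f(1) by (auto simp: tree_decomposition_def)
    then show "(u, v) \<in> (\<Union>i\<le>m. \<beta> (f i) \<times> \<beta> (f i))" by auto
  qed
  \<comment> \<open>Adhesion is bounded only along tree edges; the running intersection property
    confines the overlap with all earlier bags to the parent bag.\<close>
  have adh': "card (\<beta> (f i) \<inter> (\<Union>j<i. \<beta> (f j))) < card W" if i: "0 < i" "i \<le> m" for i
  proof -
    obtain p where p: "p < i" "(f p, f i) \<in> parcs T" "\<beta> (f i) \<inter> (\<Union>j<i. \<beta> (f j)) \<subseteq> \<beta> (f p)"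
      using f(2)[OF i] by blast
    have "finite (\<beta> (f p) \<inter> \<beta> (f i))"
      using pair_graph_finite[OF pg] i by (intro finite_subset[OF _ pair_graph_finite[OF pg]]) (auto simp: V)
    then have "card (\<beta> (f i) \<inter> (\<Union>j<i. \<beta> (f j))) \<le> card (\<beta> (f p) \<inter> \<beta> (f i))"
      using p(3) by (intro card_mono) auto
    then show ?thesis using adh[OF p(2)] \<open>s < card W\<close> by linarith
  qed
  obtain i y' where i: "i \<le> m" "model (\<beta> (f i)) (torso_arcs (parcs F) (\<beta> (f i))) W \<phi> 1 y'"
    using model_in_bag[OF pair_graph_finite[OF pg] pair_graph_sym[OF pg] pair_graph_irrefl[OF pg] V E _ adh' M]
      f(2) by blast
  have "torso F (\<beta> (f i)) \<in> \<C>" using tor f(1) i(1) by blast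
  moreover have "model (\<beta> (f i)) (parcs (torso F (\<beta> (f i)))) W \<phi> 1 y'"
    using model_mono[OF i(2) torso_arcs_subset[OF pg]] V i(1) by blast
  ultimately show thesis by (rule that)
qed

subsection \<open>The intersection form of an embedded graph\<close>

text \<open>A weight that is even on every component is a boundary. A dual certificate would be
  constant along arcs, so the set where it is 1 would be closed and of odd weight.\<close>

lemma chain_exists:
  assumes "finite U" "sym E" "irrefl E" and even: "\<And>X. closed_in E U X \<Longrightarrow> sum y X = 0"
  shows "\<exists>z :: 'a \<Rightarrow> 'a \<Rightarrow> bit. (\<forall>a b. z a b = z b a) \<and>
    (\<forall>a b. (a, b) \<notin> E \<inter> U \<times> U \<longrightarrow> z a b = 0) \<and> (\<forall>a\<in>U. (\<Sum>b\<in>U. z a b) = y a)"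
proof -
  define J where "J = E \<inter> U \<times> U"
  define A :: "'a \<Rightarrow> 'a \<times> 'a \<Rightarrow> bit" where "A = (\<lambda>a e. of_bool (fst e = a) + of_bool (snd e = a))"
  have "finite J" using assms(1) by (simp add: J_def)
  have symJ: "(b, a) \<in> J" if "(a, b) \<in> J" for a b using that assms(2) by (auto simp: J_def dest: symD)
  from bit_system_alternative[OF \<open>finite J\<close> assms(1), of A y] show ?thesis
  proof
    assume "\<exists>x. \<forall>a\<in>U. (\<Sum>e\<in>J. A a e * x e) = y a"
    then obtain x where x: "\<And>a. a \<in> U \<Longrightarrow> (\<Sum>e\<in>J. A a e * x e) = y a" by blast
    define x' where "x' = (\<lambda>a b. if (a, b) \<in> J then x (a, b) else 0)"
    define z where "z = (\<lambda>a b. x' a b + x' b a)"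
    have "(\<Sum>b\<in>U. z a b) = y a" if a: "a \<in> U" for a
    proof -
      have "(\<Sum>e\<in>J. A a e * x e) = (\<Sum>e\<in>J. (if fst e = a then x e else 0) + (if snd e = a then x e else 0))"
        by (intro sum.cong refl) (auto simp: A_def)
      also have "\<dots> = (\<Sum>e\<in>U \<times> U. (if fst e = a then x' (fst e) (snd e) else 0)
          + (if snd e = a then x' (fst e) (snd e) else 0))"
        using assms(1) by (intro sum.mono_neutral_cong_left) (auto simp: J_def x'_def)
      also have "\<dots> = (\<Sum>c\<in>U. \<Sum>d\<in>U. if c = a then x' c d else 0)
          + (\<Sum>c\<in>U. \<Sum>d\<in>U. if d = a then x' c d else 0)"
        by (simp add: sum.distrib sum.cartesian_product case_prod_beta)
      also have "(\<Sum>c\<in>U. \<Sum>d\<in>U. if c = a then x' c d else 0) = (\<Sum>d\<in>U. x' a d)"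
        using a assms(1) by (subst sum.swap) simp
      also have "(\<Sum>c\<in>U. \<Sum>d\<in>U. if d = a then x' c d else 0) = (\<Sum>c\<in>U. x' c a)"
        using a assms(1) by simp
      finally show ?thesis using x[OF a] by (simp add: z_def sum.distrib)
    qed
    moreover have "z a b = 0" if "(a, b) \<notin> E \<inter> U \<times> U" for a b
      using that symJ[of b a] by (auto simp: z_def x'_def J_def)
    ultimately show ?thesis by (intro exI[of _ z]) (auto simp: z_def add.commute)
  next
    assume "\<exists>\<eta>. (\<forall>e\<in>J. (\<Sum>a\<in>U. \<eta> a * A a e) = 0) \<and> (\<Sum>a\<in>U. \<eta> a * y a) = 1"
    then obtain \<eta> where \<eta>: "\<And>e. e \<in> J \<Longrightarrow> (\<Sum>a\<in>U. \<eta> a * A a e) = 0" "(\<Sum>a\<in>U. \<eta> a * y a) = 1"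
      by blast
    have eq: "\<eta> c = \<eta> d" if "(c, d) \<in> J" for c d
    proof -
      have "(\<Sum>a\<in>U. \<eta> a * A a (c, d)) = (\<Sum>a\<in>U. (if c = a then \<eta> a else 0) + (if d = a then \<eta> a else 0))"
        by (intro sum.cong refl) (auto simp: A_def)
      also have "\<dots> = \<eta> c + \<eta> d" using that assms(1) by (simp add: sum.distrib J_def)
      finally show ?thesis using \<eta>(1)[OF that] by (simp add: bit_add_eq_0_iff)
    qed
    have "closed_in E U {a \<in> U. \<eta> a = 1}"
      using eq unfolding closed_in_def J_def by fastforce
    then have "0 = sum y {a \<in> U. \<eta> a = 1}" using even by simp
    also have "\<dots> = (\<Sum>a\<in>U. \<eta> a * y a)"
      using assms(1) by (simp add: sum.inter_filter) (auto intro!: sum.cong)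
    finally show ?thesis using \<eta>(2) by simp
  qed
qed

lemma cyclic_enumeration:
  assumes "finite S" "S \<noteq> {} \<Longrightarrow> cyclic_on f S"
  shows "\<exists>d e. bij_betw e {..<d} S \<and> (\<forall>i. f (e i) = e (Suc i)) \<and> e d = e (0::nat)"
proof (cases "S = {}")
  case True
  \<comment> \<open>Here \<open>d\<close> is 0, yet the recurrence is required at all indices;
    iterating from an arbitrary value satisfies it.\<close>
  have "\<exists>e. \<forall>i. f (e i) = e (Suc i)" by (rule exI[of _ "\<lambda>i. (f ^^ i) undefined"]) simp
  then show ?thesis using True by (intro exI[of _ 0]) (auto simp: bij_betw_def)
next
  case False
  then obtain s where s: "s \<in> S" by blast
  have "cyclic_on f S" using assms False by blast
  then have orb: "orbit f s = S" using s by (simp add: cyclic_on_alldef)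
  then have self: "s \<in> orbit f s" using s by simp
  let ?d = "funpow_dist1 f s s" and ?e = "\<lambda>i. (f ^^ i) s"
  have "bij_betw ?e {..<?d} S"
    using orbit_conv_funpow_dist1[OF self] inj_on_funpow_dist1[OF self] orb
    by (auto simp: bij_betw_def lessThan_atLeast0)
  moreover have "?e ?d = ?e 0" using funpow_dist1_prop[OF self] by simp
  ultimately show ?thesis by (intro exI[of _ ?d] exI[of _ ?e]) simp
qed

lemma sum_mult_sum_triangle:
  fixes f g :: "nat \<Rightarrow> 'r::comm_semiring_0"
  shows "(\<Sum>i<n. f i) * (\<Sum>j<n. g j)
    = (\<Sum>j<n. \<Sum>i<j. f i * g j) + (\<Sum>j<n. \<Sum>i<j. g i * f j) + (\<Sum>i<n. f i * g i)"
  by (induction n) (simp_all add: algebra_simps sum_distrib_left sum_distrib_right)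

text \<open>\<open>e v\<close> unrolls the rotation at \<open>v\<close> from an arbitrary starting
  point, and \<open>d v\<close> is the degree. The linear order serves to orient each edge once and
  to pick a root in each component.\<close>

locale embedding =
  fixes G :: "'a :: linorder pair_pre_digraph" and \<pi> :: "'a \<Rightarrow> 'a \<Rightarrow> 'a" and sg :: "'a set \<Rightarrow> bool"
    and d :: "'a \<Rightarrow> nat" and e :: "'a \<Rightarrow> nat \<Rightarrow> 'a"
  assumes graph: "pair_graph G"
    and perm: "\<And>v. v \<in> pverts G \<Longrightarrow> \<pi> v permutes nbrs G v"
    and e_bij: "\<And>v. v \<in> pverts G \<Longrightarrow> bij_betw (e v) {..<d v} (nbrs G v)"
    and e_Suc: "\<And>v i. v \<in> pverts G \<Longrightarrow> \<pi> v (e v i) = e v (Suc i)"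
    and e_wrap: "\<And>v. v \<in> pverts G \<Longrightarrow> e v (d v) = e v 0"
begin

abbreviation "V \<equiv> pverts G"
abbreviation "E \<equiv> parcs G"

definition "fwd = {(u, v) \<in> E. u < v}"

definition "bdry c v = (\<Sum>x\<in>nbrs G v. c v x :: bit)"

definition "symm c \<longleftrightarrow> (\<forall>(u, v)\<in>E. c u v = (c v u :: bit))"

definition "cyc c \<longleftrightarrow> symm c \<and> (\<forall>v\<in>V. bdry c v = 0)"

text \<open>
  On cycles, this is the intersection form of the surface: the first sum counts crossings at the
  vertices after the rotations are cut open into linear orders, and the second one corrects for
  the edges shared by \<open>a\<close> and \<open>b\<close>.
\<close>

definition form :: "('a \<Rightarrow> 'a \<Rightarrow> bit) \<Rightarrow> ('a \<Rightarrow> 'a \<Rightarrow> bit) \<Rightarrow> bit" where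
  "form a b = (\<Sum>v\<in>V. \<Sum>j<d v. \<Sum>i<j. a v (e v i) * b v (e v j))
     + (\<Sum>(u, v)\<in>fwd. of_bool (sg {u, v}) * (a u v * b u v))"

lemma fin: "finite V" "finite E" "finite fwd" "finite (nbrs G v)"
proof -
  show V: "finite V" using graph by (rule pair_graph_finite)
  show E: "finite E" using pair_graph_arcs[OF graph] V by (meson finite_SigmaI finite_subset)
  show "finite fwd" using E by (rule finite_subset[rotated]) (auto simp: fwd_def)
  show "finite (nbrs G v)" using graph by (rule finite_nbrs)
qed

lemma arc_sym: "(u, v) \<in> E \<Longrightarrow> (v, u) \<in> E"
  using pair_graph_sym[OF graph] by (rule symD)

lemma arc_neq: "(u, v) \<in> E \<Longrightarrow> u \<noteq> v"
  using pair_graph_irrefl[OF graph] by (auto simp: irrefl_def)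

lemma arc_verts: "(u, v) \<in> E \<Longrightarrow> u \<in> V" "(u, v) \<in> E \<Longrightarrow> v \<in> V"
  using pair_graph_arcs[OF graph] by auto

lemma e_nbr: "v \<in> V \<Longrightarrow> i < d v \<Longrightarrow> (v, e v i) \<in> E"
  using e_bij[of v] by (auto simp: bij_betw_def nbrs_def)

lemma sum_nbrs: "v \<in> V \<Longrightarrow> (\<Sum>x\<in>nbrs G v. f x) = (\<Sum>i<d v. f (e v i))"
  using sum.reindex_bij_betw[OF e_bij] by metis

lemma sum_arcs_fwd:
  fixes f :: "'a \<Rightarrow> 'a \<Rightarrow> bit"
  shows "(\<Sum>v\<in>V. \<Sum>x\<in>nbrs G v. f v x) = (\<Sum>(u, v)\<in>fwd. f u v + f v u)"
proof -
  have "(\<Sum>v\<in>V. \<Sum>x\<in>nbrs G v. f v x) = (\<Sum>(u, v)\<in>E. f u v)"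
    using fin arc_verts by (subst sum.Sigma) (auto simp: nbrs_def intro!: sum.cong)
  also have "E = fwd \<union> prod.swap ` fwd"
    using arc_sym arc_neq by (fastforce simp: fwd_def image_iff)
  also have "(\<Sum>(u, v)\<in>fwd \<union> prod.swap ` fwd. f u v)
      = (\<Sum>(u, v)\<in>fwd. f u v) + (\<Sum>(u, v)\<in>prod.swap ` fwd. f u v)"
    using fin by (intro sum.union_disjoint) (auto simp: fwd_def)
  also have "(\<Sum>(u, v)\<in>prod.swap ` fwd. f u v) = (\<Sum>(u, v)\<in>fwd. f v u)"
    by (subst sum.reindex) (auto intro!: inj_onI sum.cong)
  finally show ?thesis by (simp add: sum.distrib case_prod_beta)
qed

lemma form_add_left: "form (\<lambda>u v. a u v + a' u v) b = form a b + form a' b"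
  by (simp add: form_def sum.distrib algebra_simps case_prod_beta)

lemma form_add_right: "form a (\<lambda>u v. b u v + b' u v) = form a b + form a b'"
  by (simp add: form_def sum.distrib algebra_simps case_prod_beta)

lemma form_zero_left: "form (\<lambda>u v. 0) b = 0"
  by (simp add: form_def)

lemma form_sum_left: "form (\<lambda>u v. \<Sum>i\<in>I. a i u v) b = (\<Sum>i\<in>I. form (a i) b)"
  by (induction I rule: infinite_finite_induct) (simp_all add: form_zero_left form_add_left)

lemma form_cong:
  assumes "\<And>u v. (u, v) \<in> E \<Longrightarrow> a u v = a' u v"
  shows "form a b = form a' b"
proof -
  have "a v (e v i) = a' v (e v i)" if "v \<in> V" "j < d v" "i < j" for v i j
    using assms e_nbr[of v i] that by simp
  then show ?thesis unfolding form_def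
    by (intro arg_cong2[where f = "(+)"] sum.cong refl) (auto simp: fwd_def assms)
qed

lemma form_disjoint:
  assumes "\<And>v x y. (v, x) \<in> E \<Longrightarrow> (v, y) \<in> E \<Longrightarrow> a v x * b v y = 0"
  shows "form a b = 0"
proof -
  have "a v (e v i) * b v (e v j) = 0" if "v \<in> V" "j < d v" "i < j" for v i j
    using assms e_nbr[of v i] e_nbr[of v j] that by simp
  then have "(\<Sum>v\<in>V. \<Sum>j<d v. \<Sum>i<j. a v (e v i) * b v (e v j)) = 0"
    by (intro sum.neutral ballI) auto
  moreover have "(\<Sum>(u, v)\<in>fwd. of_bool (sg {u, v}) * (a u v * b u v)) = 0"
  proof (intro sum.neutral ballI)
    fix p assume "p \<in> fwd"
    then have "(fst p, snd p) \<in> E" by (auto simp: fwd_def)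
    then have "a (fst p) (snd p) * b (fst p) (snd p) = 0" by (rule assms) fact
    then show "(case p of (u, v) \<Rightarrow> of_bool (sg {u, v}) * (a u v * b u v)) = 0"
      by (simp add: case_prod_beta)
  qed
  ultimately show ?thesis by (simp add: form_def)
qed

text \<open>The product of the boundaries at \<open>v\<close> is a sum over pairs of neighbours: the
  parts off the diagonal are the two crossing sums, the diagonal counts each edge from both ends,
  and the signature terms cancel. For chains that are not cycles, this defect is what later produces
  the value 1.\<close>

lemma form_commute:
  assumes "symm a" "symm b"
  shows "form a b + form b a = (\<Sum>v\<in>V. bdry a v * bdry b v)"
proof -
  have "(\<Sum>v\<in>V. bdry a v * bdry b v)
    = (\<Sum>v\<in>V. (\<Sum>j<d v. \<Sum>i<j. a v (e v i) * b v (e v j)) + (\<Sum>j<d v. \<Sum>i<j. b v (e v i) * a v (e v j))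
        + (\<Sum>x\<in>nbrs G v. a v x * b v x))"
    by (intro sum.cong refl) (simp add: bdry_def sum_nbrs sum_mult_sum_triangle)
  also have "\<dots> = (\<Sum>v\<in>V. \<Sum>j<d v. \<Sum>i<j. a v (e v i) * b v (e v j))
      + (\<Sum>v\<in>V. \<Sum>j<d v. \<Sum>i<j. b v (e v i) * a v (e v j))
      + (\<Sum>(u, v)\<in>fwd. a u v * b u v + a v u * b v u)"
    by (simp add: sum.distrib sum_arcs_fwd)
  also have "(\<Sum>(u, v)\<in>fwd. a u v * b u v + a v u * b v u) = 0"
  proof (intro sum.neutral ballI)
    fix p assume "p \<in> fwd"
    then obtain u v where "p = (u, v)" "(u, v) \<in> E" by (auto simp: fwd_def)
    moreover from this have "a v u = a u v" "b v u = b u v" using assms by (auto simp: symm_def)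
    ultimately show "(case p of (u, v) \<Rightarrow> a u v * b u v + a v u * b v u) = 0" by simp
  qed
  moreover have "(\<Sum>(u, v)\<in>fwd. of_bool (sg {u, v}) * (a u v * b u v))
      = (\<Sum>(u, v)\<in>fwd. of_bool (sg {u, v}) * (b u v * a u v))"
    by (simp add: mult.commute)
  ultimately show ?thesis by (simp add: form_def ac_simps)
qed

section \<open>Faces as 2-chains and their boundaries\<close>

definition "face_fun \<chi> \<longleftrightarrow> (\<forall>s\<in>E \<times> UNIV. \<chi> (face_step \<pi> sg s) = (\<chi> s :: bit) \<and> \<chi> (face_reverse sg s) = \<chi> s)"

text \<open>The two turning directions stand for the two sides of the edge, so this is the boundary
  of the 2-chain \<open>\<chi>\<close>.\<close>

definition "face_bdry \<chi> u v = (\<chi> ((u, v), True) + \<chi> ((u, v), False) :: bit)"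

lemma face_fun_reverse:
  assumes "face_fun \<chi>" "(u, v) \<in> E"
  shows "\<chi> ((v, u), s \<noteq> sg {u, v}) = \<chi> ((u, v), s)"
  using assms by (auto simp: face_fun_def face_reverse_def)

text \<open>Both states belong to the corner between \<open>x\<close> and its successor: one
  continues the walk that enters \<open>v\<close> from \<open>x\<close>, the other reverses
  it.\<close>

lemma face_fun_corner:
  assumes "face_fun \<chi>" "(v, x) \<in> E"
  shows "\<chi> ((v, \<pi> v x), True) = \<chi> ((v, x), False)"
proof -
  have xv: "((x, v), sg {x, v}) \<in> E \<times> UNIV" using arc_sym[OF assms(2)] by simp
  have "\<chi> (face_step \<pi> sg ((x, v), sg {x, v})) = \<chi> (face_reverse sg ((x, v), sg {x, v}))"
    using assms(1) xv unfolding face_fun_def by metis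
  then show ?thesis by (simp add: face_step_def face_reverse_def)
qed

lemma face_bdry_e:
  assumes "face_fun \<chi>" "v \<in> V" "i < d v"
  shows "face_bdry \<chi> v (e v i) = \<chi> ((v, e v i), True) + \<chi> ((v, e v (Suc i)), True)"
  using face_fun_corner[OF assms(1) e_nbr[OF assms(2,3)]] e_Suc[OF assms(2)]
  by (simp add: face_bdry_def)

lemma cyc_face_bdry:
  assumes "face_fun \<chi>"
  shows "cyc (face_bdry \<chi>)"
proof -
  have "face_bdry \<chi> u v = face_bdry \<chi> v u" if "(u, v) \<in> E" for u v
    using face_fun_reverse[OF assms that, of True] face_fun_reverse[OF assms that, of False]
    by (cases "sg {u, v}") (simp_all add: face_bdry_def add.commute)
  moreover have "bdry (face_bdry \<chi>) v = 0" if "v \<in> V" for v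
  proof -
    have "bdry (face_bdry \<chi>) v = (\<Sum>i<d v. \<chi> ((v, e v i), True) + \<chi> ((v, e v (Suc i)), True))"
      using that face_bdry_e[OF assms that] by (simp add: bdry_def sum_nbrs)
    also have "\<dots> = 0" using e_wrap[OF that] sum_telescope_bit[of "\<lambda>i. \<chi> ((v, e v i), True)" "d v"] by simp
    finally show ?thesis .
  qed
  ultimately show ?thesis by (auto simp: cyc_def symm_def)
qed

text \<open>Face boundaries lie in the radical of the form. The inner sums telescope along the
  rotation; the term from the arbitrary starting point is multiplied by \<open>bdry b v = 0\<close>,
  and the rest is a sum over edges equal to the signature term.\<close>

lemma form_face_bdry:
  assumes "face_fun \<chi>" "cyc b"
  shows "form (face_bdry \<chi>) b = 0"
proof -
  have "(\<Sum>j<d v. \<Sum>i<j. face_bdry \<chi> v (e v i) * b v (e v j)) = (\<Sum>x\<in>nbrs G v. \<chi> ((v, x), True) * b v x)"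
    if v: "v \<in> V" for v
  proof -
    have "(\<Sum>i<j. face_bdry \<chi> v (e v i) * b v (e v j))
        = (\<chi> ((v, e v 0), True) + \<chi> ((v, e v j), True)) * b v (e v j)" if "j < d v" for j
    proof -
      have "(\<Sum>i<j. face_bdry \<chi> v (e v i))
          = (\<Sum>i<j. \<chi> ((v, e v i), True) + \<chi> ((v, e v (Suc i)), True))"
        using that by (intro sum.cong refl face_bdry_e[OF assms(1) v]) simp
      also have "\<dots> = \<chi> ((v, e v 0), True) + \<chi> ((v, e v j), True)"
        by (rule sum_telescope_bit)
      finally show ?thesis by (simp only: sum_distrib_right[symmetric])
    qed
    then have "(\<Sum>j<d v. \<Sum>i<j. face_bdry \<chi> v (e v i) * b v (e v j))
        = (\<Sum>j<d v. (\<chi> ((v, e v 0), True) + \<chi> ((v, e v j), True)) * b v (e v j))"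
      by simp
    also have "\<dots> = \<chi> ((v, e v 0), True) * bdry b v + (\<Sum>x\<in>nbrs G v. \<chi> ((v, x), True) * b v x)"
      using v by (simp add: bdry_def sum_nbrs sum.distrib distrib_right sum_distrib_left)
    finally show ?thesis using assms(2) v by (simp add: cyc_def)
  qed
  then have "(\<Sum>v\<in>V. \<Sum>j<d v. \<Sum>i<j. face_bdry \<chi> v (e v i) * b v (e v j))
      = (\<Sum>(u, v)\<in>fwd. \<chi> ((u, v), True) * b u v + \<chi> ((v, u), True) * b v u)"
    by (simp add: sum_arcs_fwd)
  also have "\<dots> = (\<Sum>(u, v)\<in>fwd. of_bool (sg {u, v}) * (face_bdry \<chi> u v * b u v))"
  proof (intro sum.cong refl)
    fix p assume "p \<in> fwd"
    then obtain u v where p: "p = (u, v)" "(u, v) \<in> E" by (auto simp: fwd_def)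
    moreover have "b v u = b u v" using assms(2) p by (auto simp: cyc_def symm_def)
    \<comment> \<open>The state \<open>True\<close> at both ends means opposite sides of a positive
      edge but the same side of a negative one; this explains the factor \<open>sg\<close> in
      \<open>form\<close>.\<close>
    moreover have "\<chi> ((v, u), True) = (if sg {u, v} then \<chi> ((u, v), False) else \<chi> ((u, v), True))"
      using face_fun_reverse[OF assms(1) p(2), of "\<not> sg {u, v}"] by auto
    ultimately show "(case p of (u, v) \<Rightarrow> \<chi> ((u, v), True) * b u v + \<chi> ((v, u), True) * b v u)
        = (case p of (u, v) \<Rightarrow> of_bool (sg {u, v}) * (face_bdry \<chi> u v * b u v))"
      by (simp add: face_bdry_def distrib_right)
  qed
  finally show ?thesis by (simp add: form_def)
qed

lemma face_fun_kernel_vertex: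
  assumes "face_fun \<chi>" "\<And>u v. (u, v) \<in> E \<Longrightarrow> face_bdry \<chi> u v = 0" "(v, x) \<in> E"
  shows "\<chi> ((v, x), s) = \<chi> ((v, e v 0), True)"
proof -
  have v: "v \<in> V" using arc_verts assms(3) by blast
  have ind: "i < d v \<Longrightarrow> \<chi> ((v, e v i), True) = \<chi> ((v, e v 0), True)" for i
  proof (induction i)
    case (Suc i)
    then have "face_bdry \<chi> v (e v i) = 0" using assms(2) e_nbr[OF v] by simp
    then show ?case using Suc face_bdry_e[OF assms(1) v, of i] by (simp add: bit_add_eq_0_iff)
  qed simp
  obtain i where i: "i < d v" "x = e v i"
    using assms(3) e_bij[OF v] by (auto simp: bij_betw_def nbrs_def)
  have "\<chi> ((v, x), s) = \<chi> ((v, x), True)"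
    using assms(2)[OF assms(3)] by (cases s) (simp_all add: face_bdry_def bit_add_eq_0_iff)
  also have "\<dots> = \<chi> ((v, e v 0), True)" unfolding i(2) by (rule ind[OF i(1)])
  finally show ?thesis .
qed

text \<open>With zero boundary, the values agree across edges and around corners, hence at each
  vertex and then along every path.\<close>

lemma face_fun_kernel:
  assumes \<chi>: "face_fun \<chi>" "\<And>u v. (u, v) \<in> E \<Longrightarrow> face_bdry \<chi> u v = 0"
    and "(u, v) \<in> E\<^sup>*" "(u, x) \<in> E" "(v, y) \<in> E"
  shows "\<chi> ((u, x), s) = \<chi> ((v, y), t)"
proof -
  have "(u, v) \<in> E\<^sup>* \<Longrightarrow> \<chi> ((u, e u 0), True) = \<chi> ((v, e v 0), True)" for v
  proof (induction rule: rtrancl_induct)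
    case (step v w)
    have "\<chi> ((v, e v 0), True) = \<chi> ((v, w), True)"
      using face_fun_kernel_vertex[OF \<chi> step(2)] by simp
    also have "\<dots> = \<chi> ((w, v), True \<noteq> sg {v, w})" by (rule face_fun_reverse[OF \<chi>(1) step(2), symmetric])
    also have "\<dots> = \<chi> ((w, e w 0), True)" by (rule face_fun_kernel_vertex[OF \<chi> arc_sym[OF step(2)]])
    finally show ?case using step.IH by simp
  qed simp
  then show ?thesis using assms face_fun_kernel_vertex[OF \<chi>] by metis
qed


lemma face_step_closed: "s \<in> E \<times> UNIV \<Longrightarrow> face_step \<pi> sg s \<in> E \<times> UNIV"
proof -
  assume "s \<in> E \<times> UNIV"
  then obtain u v b where s: "s = ((u, v), b)" "(u, v) \<in> E" by (cases s) auto
  have p: "\<pi> v permutes nbrs G v" using perm arc_verts(2)[OF s(2)] by blast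
  have "u \<in> nbrs G v" using arc_sym[OF s(2)] by (simp add: nbrs_def)
  then have "\<pi> v u \<in> nbrs G v" "inv (\<pi> v) u \<in> nbrs G v"
    using permutes_in_image[OF p] permutes_in_image[OF permutes_inv[OF p]] by blast+
  then show ?thesis by (auto simp: s face_step_def nbrs_def Let_def)
qed

lemma face_reverse_closed: "s \<in> E \<times> UNIV \<Longrightarrow> face_reverse sg s \<in> E \<times> UNIV"
  by (auto simp: face_reverse_def intro: arc_sym)

lemma face_reverse_reverse: "face_reverse sg (face_reverse sg s) = s"
  by (cases s) (auto simp: face_reverse_def insert_commute)

text \<open>Reversal conjugates the step into its inverse. This gives injectivity of the step and
  shows that a reversed facial walk is again one.\<close>

lemma face_step_reverse_step:
  assumes "s \<in> E \<times> UNIV"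
  shows "face_step \<pi> sg (face_reverse sg (face_step \<pi> sg s)) = face_reverse sg s"
proof -
  obtain u v b where s: "s = ((u, v), b)" "(u, v) \<in> E" using assms by (cases s) auto
  have p: "\<pi> v permutes nbrs G v" using perm arc_verts(2)[OF s(2)] by blast
  have "inv (\<pi> v) (\<pi> v u) = u" "\<pi> v (inv (\<pi> v) u) = u"
    using permutes_inverses[OF p] by auto
  then show ?thesis
    by (auto simp: s face_step_def face_reverse_def Let_def insert_commute)
qed

text \<open>\<open>orbit\<close> collects the states after at least one step. On the finite set of
  states over arcs the step is a permutation, so the starting state recurs.\<close>

lemma orbit_face_step:
  assumes "s \<in> E \<times> UNIV"
  shows "orbit (face_step \<pi> sg) (face_step \<pi> sg s) = orbit (face_step \<pi> sg) s"
proof -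
  let ?S = "E \<times> (UNIV :: bool set)" and ?f = "face_step \<pi> sg"
  define g where "g = perm_restrict ?f ?S"
  have "finite ?S" using fin by simp
  have "inj_on ?f ?S"
    by (rule inj_onI) (metis face_step_reverse_step face_reverse_reverse)
  moreover have "?f ` ?S \<subseteq> ?S" using face_step_closed by blast
  then have "?f ` ?S = ?S" using endo_inj_surj[OF \<open>finite ?S\<close>] calculation by blast
  ultimately have "bij_betw ?f ?S ?S" by (simp add: bij_betw_def)
  then have "bij_betw g ?S ?S"
    by (rule bij_betw_cong[THEN iffD1, rotated]) (simp add: g_def perm_restrict_def)
  then have "g permutes ?S" by (rule bij_imp_permutes) (simp add: g_def perm_restrict_def)
  then have "permutation g" using \<open>finite ?S\<close> permutation_permutes by blast
  have "orbit ?f s = orbit g s"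
    by (rule orbit_cong0[of s ?S]) (use assms face_step_closed in \<open>auto simp: g_def perm_restrict_def\<close>)
  then have "s \<in> orbit ?f s" using permutation_self_in_orbit[OF \<open>permutation g\<close>] by simp
  then show ?thesis by (rule self_in_orbit_step)
qed

definition "face s = orbit (face_step \<pi> sg) s \<union> orbit (face_step \<pi> sg) (face_reverse sg s)"

lemma faces_eq: "faces G \<pi> sg = face ` (E \<times> UNIV)"
  by (auto simp: faces_def face_def)

lemma face_fun_face: "face_fun (\<lambda>s. of_bool (face s \<in> \<A>))"
proof -
  have "face (face_step \<pi> sg s) = face s" "face (face_reverse sg s) = face s" if s: "s \<in> E \<times> UNIV" for s
  proof -
    have "orbit (face_step \<pi> sg) (face_reverse sg (face_step \<pi> sg s))
        = orbit (face_step \<pi> sg) (face_reverse sg s)"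
      using orbit_face_step[OF face_reverse_closed[OF face_step_closed[OF s]]]
      by (simp add: face_step_reverse_step[OF s])
    then show "face (face_step \<pi> sg s) = face s" using orbit_face_step[OF s] by (simp add: face_def)
    show "face (face_reverse sg s) = face s" by (auto simp: face_def face_reverse_reverse)
  qed
  then show ?thesis by (simp add: face_fun_def)
qed

lemma bdry_add: "bdry (\<lambda>u v. a u v + b u v) v = bdry a v + bdry b v"
  by (simp add: bdry_def sum.distrib)

lemma bdry_sum: "bdry (\<lambda>u v. \<Sum>i\<in>I. a i u v) v = (\<Sum>i\<in>I. bdry (a i) v)"
  unfolding bdry_def by (rule sum.swap)

lemma bdry_cong: "(\<And>u v. (u, v) \<in> E \<Longrightarrow> a u v = a' u v) \<Longrightarrow> bdry a v = bdry a' v"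
  by (simp add: bdry_def nbrs_def)

lemma symmI: "(\<And>u v. (u, v) \<in> E \<Longrightarrow> c u v = c v u) \<Longrightarrow> symm c"
  by (auto simp: symm_def)

lemma symmD: "symm c \<Longrightarrow> (u, v) \<in> E \<Longrightarrow> c u v = c v u"
  by (auto simp: symm_def)

lemma symm_add: "symm a \<Longrightarrow> symm b \<Longrightarrow> symm (\<lambda>u v. a u v + b u v)"
proof (rule symmI)
  fix u v assume ab: "symm a" "symm b" "(u, v) \<in> E"
  show "a u v + b u v = a v u + b v u" using symmD[OF ab(1,3)] symmD[OF ab(2,3)] by simp
qed

lemma symm_sum: "(\<And>i. i \<in> I \<Longrightarrow> symm (a i)) \<Longrightarrow> symm (\<lambda>u v. \<Sum>i\<in>I. a i u v)"
  by (rule symmI, rule sum.cong) (auto intro: symmD)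

lemma card_fwd: "card fwd = card (edges G)"
proof (rule bij_betw_same_card[of "\<lambda>(u, v). {u, v}"])
  have "edges G = (\<lambda>(u, v). {u, v}) ` fwd"
  proof (intro equalityI subsetI)
    fix x assume "x \<in> edges G"
    then obtain u v where uv: "x = {u, v}" "(u, v) \<in> E" by (auto simp: edges_def)
    then have "(u, v) \<in> fwd \<or> (v, u) \<in> fwd" using arc_neq[OF uv(2)] arc_sym by (auto simp: fwd_def)
    then show "x \<in> (\<lambda>(u, v). {u, v}) ` fwd" using uv(1) by (force simp: insert_commute)
  qed (auto simp: edges_def fwd_def)
  moreover have "inj_on (\<lambda>(u, v). {u, v}) fwd"
    by (auto simp: inj_on_def fwd_def doubleton_eq_iff)
  ultimately show "bij_betw (\<lambda>(u, v). {u, v}) fwd (edges G)" by (simp add: bij_betw_def)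
qed

text \<open>
  For sets \<open>I\<close>, \<open>\<A>\<close>, \<open>X\<close> of indices, of non-root faces and of non-root vertices, the sum of the
  cycles \<open>a i\<close>, the boundaries of the faces and the paths from \<open>x\<close> to the root of its component
  determines \<open>X\<close> by its boundary, then \<open>I\<close> by the intersection numbers with the \<open>b j\<close>, and then \<open>\<A>\<close>
  because the dual graph of each component is connected. Counting gives Euler's inequality.
\<close>

lemma genus_lower_bound:
  assumes a: "\<And>i. i < m \<Longrightarrow> cyc (a i)" and b: "\<And>i. i < m \<Longrightarrow> cyc (b i)"
    and ab: "\<And>i j. i < m \<Longrightarrow> j < m \<Longrightarrow> form (a i) (b j) = of_bool (i = j)"
  shows "int m \<le> scheme_genus G \<pi> sg"
proof -
  define comp where "comp = (\<lambda>v. {u \<in> V. (v, u) \<in> E\<^sup>*})"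
  have comp_eq: "comp u = comp v" if "(u, v) \<in> E\<^sup>*" for u v
    using that symD[OF sym_rtrancl[OF pair_graph_sym[OF graph]] that]
    unfolding comp_def by (auto intro: rtrancl_trans)
  have fin_comp: "finite (comp v)" for v using fin by (simp add: comp_def)
  have self: "v \<in> comp v" if "v \<in> V" for v using that by (simp add: comp_def)
  define r where "r = (\<lambda>v. Min (comp v))"
  have r: "r v \<in> V" "(v, r v) \<in> E\<^sup>*" if "v \<in> V" for v
    using Min_in[OF fin_comp, of v] self[OF that] by (auto simp: r_def comp_def)
  define Rt where "Rt = r ` V"
  have "inj_on Min (comp ` V)"
  proof (rule inj_onI, clarify)
    fix u v assume "u \<in> V" "v \<in> V" "Min (comp u) = Min (comp v)"
    then have "(u, r u) \<in> E\<^sup>*" "(v, r u) \<in> E\<^sup>*" using r(2)[of u] r(2)[of v] by (simp_all add: r_def)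
    then show "comp u = comp v" using comp_eq by metis
  qed
  moreover have "Rt = Min ` (comp ` V)" by (auto simp: Rt_def r_def)
  ultimately have card_Rt: "card Rt = card (components G)"
    by (simp add: components_eq[OF graph] comp_def card_image)
  have "Rt \<subseteq> V" using r by (auto simp: Rt_def)
  have fin_Rt: "finite Rt" using fin by (simp add: Rt_def)
  \<comment> \<open>A path from \<open>x\<close> to its root, modulo 2; it exists because a closed
    set contains both ends or neither.\<close>
  have "\<exists>z. symm z \<and> (\<forall>v\<in>V. bdry z v = of_bool (v = x) + of_bool (v = r x))" if x: "x \<in> V" for x
  proof -
    let ?y = "\<lambda>v. of_bool (v = x) + of_bool (v = r x) :: bit"
    have "sum ?y X = 0" if X: "closed_in E V X" for X
    proof -
      have cl: "v \<in> X" if "(u, v) \<in> E\<^sup>*" "u \<in> X" for u v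
        using that by (induction rule: rtrancl_induct) (use X arc_verts in \<open>auto simp: closed_in_def\<close>)
      have "x \<in> X \<longleftrightarrow> r x \<in> X"
        using cl[OF r(2)[OF x]] cl[OF symD[OF sym_rtrancl[OF pair_graph_sym[OF graph]] r(2)[OF x]]] by blast
      moreover have "finite X" using X fin by (auto simp: closed_in_def intro: finite_subset)
      ultimately show ?thesis by (simp add: sum.distrib sum_of_bool_delta del: sum_of_bool_eq)
    qed
    from chain_exists[OF fin(1) pair_graph_sym[OF graph] pair_graph_irrefl[OF graph] this]
    obtain z where z: "\<And>a b. z a b = z b a" "\<And>a b. (a, b) \<notin> E \<inter> V \<times> V \<Longrightarrow> z a b = 0"
      "\<And>a. a \<in> V \<Longrightarrow> (\<Sum>b\<in>V. z a b) = ?y a" by blast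
    have "bdry z v = ?y v" if "v \<in> V" for v
    proof -
      have "bdry z v = (\<Sum>b\<in>V. z v b)" unfolding bdry_def
        by (rule sum.mono_neutral_left) (use fin arc_verts z(2) in \<open>auto simp: nbrs_def\<close>)
      then show ?thesis using z(3)[OF that] by simp
    qed
    moreover have "symm z" using z(1) by (auto simp: symm_def)
    ultimately show ?thesis by blast
  qed
  then obtain P where P: "\<And>x. x \<in> V \<Longrightarrow> symm (P x)"
    "\<And>x v. x \<in> V \<Longrightarrow> v \<in> V \<Longrightarrow> bdry (P x) v = of_bool (v = x) + of_bool (v = r x)" by metis
  \<comment> \<open>An isolated vertex is a root without states, so \<open>faces\<close> holds no
    face for it; \<open>face_count\<close> adds it separately, and the count below has to agree with
    that.\<close>
  define Iso where "Iso = {v \<in> V. nbrs G v = {}}"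
  have "Iso \<subseteq> Rt"
  proof
    fix v assume v: "v \<in> Iso"
    have "u = v" if "(v, u) \<in> E\<^sup>*" for u
      using that v by (cases rule: converse_rtranclE) (auto simp: Iso_def nbrs_def)
    then have "comp v = {v}" using v by (auto simp: comp_def Iso_def)
    then have "r v = v" by (simp add: r_def)
    moreover have "v \<in> V" using v by (simp add: Iso_def)
    ultimately show "v \<in> Rt" unfolding Rt_def by (metis imageI)
  qed
  have e0: "(v, e v 0) \<in> E" if "v \<in> V" "v \<notin> Iso" for v
  proof -
    have "nbrs G v \<noteq> {}" using that by (simp add: Iso_def)
    then have "d v \<noteq> 0" using e_bij[OF that(1)] by (auto simp: bij_betw_def)
    then show ?thesis using e_nbr[OF that(1)] by simp
  qed
  \<comment> \<open>Each component with an edge gives up one face, since all its faces together have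
    zero boundary.\<close>
  define F0 where "F0 = (\<lambda>v. face ((v, e v 0), True)) ` (Rt - Iso)"
  define F1 where "F1 = faces G \<pi> sg - F0"
  have finF: "finite (faces G \<pi> sg)" using fin by (simp add: faces_eq)
  have "F0 \<subseteq> faces G \<pi> sg" using e0 \<open>Rt \<subseteq> V\<close> by (auto simp: F0_def faces_eq)
  then have "card F1 = card (faces G \<pi> sg) - card F0" "card F0 \<le> card (faces G \<pi> sg)"
    using finF by (auto simp: F1_def card_Diff_subset finite_subset card_mono)
  moreover have "card F0 \<le> card Rt - card Iso"
    using card_image_le[of "Rt - Iso" "\<lambda>v. face ((v, e v 0), True)"] fin_Rt \<open>Iso \<subseteq> Rt\<close>
    by (simp add: F0_def card_Diff_subset finite_subset)
  moreover have "card Iso \<le> card Rt" using fin_Rt \<open>Iso \<subseteq> Rt\<close> by (rule card_mono)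
  ultimately have F1: "int (card F1) \<ge> int (card (faces G \<pi> sg)) - int (card Rt) + int (card Iso)"
    by linarith
  define \<chi> where "\<chi> = (\<lambda>\<A> s. of_bool (face s \<in> \<A>) :: bit)"
  have \<chi>: "face_fun (\<chi> \<A>)" for \<A> unfolding \<chi>_def by (rule face_fun_face)
  define C where "C = (\<lambda>I \<A> X u v. (\<Sum>i\<in>I. a i u v) + (face_bdry (\<chi> \<A>) u v + (\<Sum>x\<in>X. P x u v)))"
  define \<Phi> where "\<Phi> = (\<lambda>(I, \<A>, X). restrict (\<lambda>(u, v). C I \<A> X u v) fwd)"
  let ?D = "Pow {..<m} \<times> Pow F1 \<times> Pow (V - Rt)"
  have symC: "symm (C I \<A> X)" if "I \<subseteq> {..<m}" "X \<subseteq> V - Rt" for I \<A> X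
    unfolding C_def using that a P(1) cyc_face_bdry[OF \<chi>]
    by (intro symm_add symm_sum) (auto simp: cyc_def)
  have bdryC: "bdry (C I \<A> X) v = of_bool (v \<in> X)"
    if I: "I \<subseteq> {..<m}" and X: "X \<subseteq> V - Rt" and v: "v \<in> V - Rt" for I \<A> X v
  proof -
    have "(\<Sum>i\<in>I. bdry (a i) v) = 0" using a I v by (intro sum.neutral) (auto simp: cyc_def)
    moreover have "bdry (face_bdry (\<chi> \<A>)) v = 0" using cyc_face_bdry[OF \<chi>] v by (simp add: cyc_def)
    moreover have "(\<Sum>x\<in>X. bdry (P x) v) = (\<Sum>x\<in>X. of_bool (x = v))"
    proof (intro sum.cong refl)
      fix x assume "x \<in> X"
      then have x: "x \<in> V" using X by blast
      then have "r x \<in> Rt" by (simp add: Rt_def)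
      then have "v \<noteq> r x" using v by blast
      then show "bdry (P x) v = of_bool (x = v)" using P(2)[OF x, of v] v by (simp add: eq_commute)
    qed
    moreover have "finite X" using X fin finite_subset by blast
    ultimately show ?thesis unfolding C_def
      by (simp add: bdry_add bdry_sum sum_of_bool_delta del: sum_of_bool_eq)
  qed
  have formC: "form (C I \<A> X) (b j) = of_bool (j \<in> I) + (\<Sum>x\<in>X. form (P x) (b j))"
    if I: "I \<subseteq> {..<m}" and j: "j < m" for I \<A> X j
  proof -
    have "(\<Sum>i\<in>I. form (a i) (b j)) = (\<Sum>i\<in>I. of_bool (i = j))"
      using ab I j by (intro sum.cong) auto
    moreover have "finite I" using I finite_subset by blast
    ultimately show ?thesis unfolding C_def
      by (simp add: form_add_left form_sum_left form_face_bdry[OF \<chi> b[OF j]] sum_of_bool_delta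
          del: sum_of_bool_eq)
  qed
  have "inj_on \<Phi> ?D"
  proof (rule inj_onI)
    fix p q assume pq: "p \<in> ?D" "q \<in> ?D" "\<Phi> p = \<Phi> q"
    obtain I \<A> X I' \<A>' X' where p: "p = (I, \<A>, X)" and q: "q = (I', \<A>', X')"
      by (cases p, cases q) auto
    have sub: "I \<subseteq> {..<m}" "\<A> \<subseteq> F1" "X \<subseteq> V - Rt" "I' \<subseteq> {..<m}" "\<A>' \<subseteq> F1" "X' \<subseteq> V - Rt"
      and eq: "\<Phi> (I, \<A>, X) = \<Phi> (I', \<A>', X')"
      using pq unfolding p q by blast+
    have fwd: "C I \<A> X u v = C I' \<A>' X' u v" if "(u, v) \<in> fwd" for u v
      using fun_cong[OF eq, of "(u, v)"] that by (simp add: \<Phi>_def)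
    have CE: "C I \<A> X u v = C I' \<A>' X' u v" if "(u, v) \<in> E" for u v
    proof (cases "u < v")
      case False
      then have "(v, u) \<in> fwd" using that arc_neq[OF that] arc_sym[OF that] by (auto simp: fwd_def)
      then have "C I \<A> X v u = C I' \<A>' X' v u" by (rule fwd)
      then show ?thesis
        using symmD[OF symC[OF sub(1,3)] that] symmD[OF symC[OF sub(4,6)] that] by simp
    qed (use that fwd in \<open>simp add: fwd_def\<close>)
    have "v \<in> X \<longleftrightarrow> v \<in> X'" if "v \<in> V - Rt" for v
      using bdry_cong[of "C I \<A> X" "C I' \<A>' X'" v, OF CE] bdryC[OF sub(1,3) that, of \<A>] bdryC[OF sub(4,6) that, of \<A>']
      by (cases "v \<in> X"; cases "v \<in> X'") simp_all
    then have X: "X = X'" using sub by blast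
    have "j \<in> I \<longleftrightarrow> j \<in> I'" if "j < m" for j
      using form_cong[of "C I \<A> X" "C I' \<A>' X'" "b j", OF CE] formC[OF sub(1) that, of \<A> X] formC[OF sub(4) that, of \<A>' X']
      by (cases "j \<in> I"; cases "j \<in> I'") (simp_all add: X)
    then have I: "I = I'" using sub(1,4) by blast
    \<comment> \<open>The difference of the two face chains has zero boundary and vanishes on the
      root faces, so it vanishes everywhere.\<close>
    define \<psi> where "\<psi> = (\<lambda>s. \<chi> \<A> s + \<chi> \<A>' s)"
    have "face_fun \<psi>" using \<chi>[of \<A>] \<chi>[of \<A>'] by (simp add: face_fun_def \<psi>_def)
    have \<psi>0: "face_bdry \<psi> u v = 0" if "(u, v) \<in> E" for u v
    proof -
      have "face_bdry \<psi> u v = face_bdry (\<chi> \<A>) u v + face_bdry (\<chi> \<A>') u v"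
        by (simp add: face_bdry_def \<psi>_def ac_simps)
      then show ?thesis using CE[OF that] by (simp add: C_def X I)
    qed
    have same: "f \<in> \<A> \<longleftrightarrow> f \<in> \<A>'" if f: "f \<in> F1" for f
    proof -
      obtain u v s where f': "f = face ((u, v), s)" "(u, v) \<in> E" using f by (auto simp: F1_def faces_eq)
      have u: "u \<in> V" using arc_verts f' by blast
      define x where "x = r u"
      have x: "x \<in> V" "x \<in> Rt" "(u, x) \<in> E\<^sup>*" using r[OF u] u by (auto simp: x_def Rt_def)
      have "x \<notin> Iso"
      proof
        assume "x \<in> Iso"
        have "(x, u) \<in> E\<^sup>*" using x(3) symD[OF sym_rtrancl[OF pair_graph_sym[OF graph]]] by blast
        then have "x = u"
          by (cases rule: converse_rtranclE) (use \<open>x \<in> Iso\<close> in \<open>auto simp: Iso_def nbrs_def\<close>)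
        then show False using \<open>x \<in> Iso\<close> f'(2) by (auto simp: Iso_def nbrs_def)
      qed
      then have "face ((x, e x 0), True) \<in> F0" using x by (auto simp: F0_def)
      then have "\<psi> ((x, e x 0), True) = 0" using sub(2,5) by (auto simp: \<psi>_def \<chi>_def F1_def)
      moreover have "\<psi> ((u, v), s) = \<psi> ((x, e x 0), True)"
        by (rule face_fun_kernel[OF \<open>face_fun \<psi>\<close> \<psi>0 x(3) f'(2) e0[OF x(1) \<open>x \<notin> Iso\<close>]])
      ultimately have "of_bool (f \<in> \<A>) = (of_bool (f \<in> \<A>') :: bit)"
        by (simp add: \<psi>_def \<chi>_def f'(1) bit_add_eq_0_iff)
      then show ?thesis by (cases "f \<in> \<A>"; cases "f \<in> \<A>'") simp_all
    qed
    have "\<A> = \<A>'" using same sub(2,5) by blast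
    then show "p = q" using X I p q by simp
  qed
  moreover have "\<Phi> ` ?D \<subseteq> fwd \<rightarrow>\<^sub>E {0, 1}"
  proof -
    have "x \<in> {0, 1}" for x :: bit by (cases x) auto
    then show ?thesis by (auto simp: \<Phi>_def)
  qed
  moreover have "finite (fwd \<rightarrow>\<^sub>E {0, 1 :: bit})" using fin by (intro finite_PiE) auto
  ultimately have "card ?D \<le> card (fwd \<rightarrow>\<^sub>E {0, 1 :: bit})" by (rule card_inj_on_le)
  also have "\<dots> = 2 ^ card fwd" using fin by (simp add: card_PiE numeral_2_eq_2)
  finally have "(2::nat) ^ (m + card F1 + card (V - Rt)) \<le> 2 ^ card fwd"
    using fin finF by (simp add: F1_def card_Pow card_cartesian_product power_add mult.assoc)
  then have "m + card F1 + card (V - Rt) \<le> card fwd" by (rule power_le_imp_le_exp[rotated]) simp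
  moreover have "int (card (V - Rt)) = int (card V) - int (card Rt)"
    using fin fin_Rt \<open>Rt \<subseteq> V\<close> by (simp add: card_Diff_subset card_mono of_nat_diff)
  ultimately show ?thesis
    using F1 by (simp add: scheme_genus_def face_count_def card_Rt card_fwd flip: Iso_def)
qed

section \<open>From homological complete minors to genus\<close>

text \<open>The chain plays the part of the edge between \<open>w\<close> and \<open>w'\<close>; its
  end points are the weights on the two fibres.\<close>

lemma model_chain:
  assumes M: "model V E W \<phi> 1 y" and w: "w \<in> W" "w' \<in> W" "w \<noteq> w'"
  shows "\<exists>z. symm z \<and> (\<forall>a b. \<phi> a \<notin> {w, w'} \<longrightarrow> z a b = 0) \<and>
    (\<forall>v\<in>V. bdry z v = (if \<phi> v \<in> {w, w'} then y v else 0))"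
proof -
  let ?U = "{a \<in> V. \<phi> a \<in> {w, w'}}"
  have "finite ?U" using fin by simp
  have "\<exists>z. (\<forall>a b. z a b = z b a) \<and> (\<forall>a b. (a, b) \<notin> E \<inter> ?U \<times> ?U \<longrightarrow> z a b = 0) \<and>
      (\<forall>a\<in>?U. (\<Sum>b\<in>?U. z a b) = y a)"
    by (rule chain_exists[OF \<open>finite ?U\<close> pair_graph_sym[OF graph] pair_graph_irrefl[OF graph]])
      (rule modelD2[OF M w])
  then obtain z where z: "\<And>a b. z a b = z b a" "\<And>a b. (a, b) \<notin> E \<inter> ?U \<times> ?U \<Longrightarrow> z a b = 0"
    "\<And>a. a \<in> ?U \<Longrightarrow> (\<Sum>b\<in>?U. z a b) = y a" by blast
  have "bdry z v = (\<Sum>b\<in>?U. z v b)" for v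
    unfolding bdry_def
  proof (rule sum.mono_neutral_cong)
    show "z v b = 0" if "b \<in> ?U - nbrs G v" for b using that z(2)[of v b] by (auto simp: nbrs_def)
    show "z v b = 0" if "b \<in> nbrs G v - ?U" for b using that z(2)[of v b] by blast
  qed (use fin in auto)
  then have "bdry z v = (if \<phi> v \<in> {w, w'} then y v else 0)" if "v \<in> V" for v
    using z(2)[of v] z(3)[of v] that by auto
  moreover have "symm z" using z(1) by (auto simp: symm_def)
  moreover have "z a b = 0" if "\<phi> a \<notin> {w, w'}" for a b using z(2)[of a b] that by blast
  ultimately show ?thesis by blast
qed

text \<open>
  Write \<open>T i j\<close> for the image of the triangle \<open>0ij\<close>. The intersection numbers of the three pairs of such
  triangles that share only the vertex 0 sum to 1: contributions of disjoint edges vanish, and the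
  others pair up by \<open>form_commute\<close>.
\<close>

lemma crossing_cycles_K5:
  assumes M: "model V E W \<phi> 1 y" and w: "inj_on w {..<5 :: nat}" "w ` {..<5} \<subseteq> W"
  shows "\<exists>a b. cyc a \<and> cyc b \<and> form a b = 1 \<and>
    (\<forall>v x. \<phi> v \<notin> w ` {..<5} \<longrightarrow> a v x = 0 \<and> b v x = 0)"
proof -
  have neq: "w i \<noteq> w j" if "i < 5" "j < 5" "i \<noteq> j" for i j using w(1) that by (auto simp: inj_on_def)
  define Q where "Q = (\<lambda>i j z. i < 5 \<and> j < 5 \<and> i \<noteq> j \<longrightarrow>
    symm z \<and> (\<forall>a b. \<phi> a \<notin> {w i, w j} \<longrightarrow> z a b = 0) \<and>
    (\<forall>v\<in>V. bdry z v = (if \<phi> v \<in> {w i, w j} then y v else 0)))"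
  have "\<exists>z. Q i j z" for i j
  proof (cases "i < 5 \<and> j < 5 \<and> i \<noteq> j")
    case True
    then have "w i \<in> W" "w j \<in> W" "w i \<noteq> w j" using w(2) neq by auto
    then show ?thesis unfolding Q_def using model_chain[OF M] by blast
  next
    case False
    then show ?thesis unfolding Q_def by blast
  qed
  then obtain Z where "\<And>i j. Q i j (Z i j)" by metis
  then have Z: "i < 5 \<Longrightarrow> j < 5 \<Longrightarrow> i \<noteq> j \<Longrightarrow> symm (Z i j)"
    "i < 5 \<Longrightarrow> j < 5 \<Longrightarrow> i \<noteq> j \<Longrightarrow> \<phi> a \<notin> {w i, w j} \<Longrightarrow> Z i j a b = 0"
    "i < 5 \<Longrightarrow> j < 5 \<Longrightarrow> i \<noteq> j \<Longrightarrow> v \<in> V \<Longrightarrow>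
      bdry (Z i j) v = (if \<phi> v \<in> {w i, w j} then y v else 0)" for i j a b v
    unfolding Q_def by blast+
  \<comment> \<open>The weights over each corner of the triangle occur in two of the three
    boundaries, so the sum is a cycle.\<close>
  define T where "T = (\<lambda>i j u v. Z 0 i u v + Z 0 j u v + Z i j u v)"
  have T: "cyc (T i j)" if ij: "0 < i" "i < 5" "0 < j" "j < 5" "i \<noteq> j" for i j
  proof -
    have "bdry (T i j) v = 0" if "v \<in> V" for v
      using that ij neq[of 0 i] neq[of 0 j] neq[of i j] by (auto simp: T_def bdry_add Z(3))
    moreover have "symm (T i j)" unfolding T_def using ij by (intro symm_add Z(1)) auto
    ultimately show ?thesis by (simp add: cyc_def)
  qed
  have supp: "T i j v x = 0" if "0 < i" "i < 5" "0 < j" "j < 5" "i \<noteq> j" "\<phi> v \<notin> w ` {..<5}" for i j v x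
  proof -
    have "\<phi> v \<noteq> w k" if "k < 5" for k using \<open>\<phi> v \<notin> _\<close> that by auto
    then show ?thesis using that(1-5) by (simp add: T_def Z(2))
  qed
  have disj: "form (Z i j) (Z k l) = 0"
    if "i < 5" "j < 5" "k < 5" "l < 5" "i \<noteq> j" "k \<noteq> l" "i \<noteq> k" "i \<noteq> l" "j \<noteq> k" "j \<noteq> l" for i j k l
  proof (rule form_disjoint)
    fix v x x'
    have "\<phi> v \<notin> {w i, w j} \<or> \<phi> v \<notin> {w k, w l}" using neq[of i k] neq[of i l] neq[of j k] neq[of j l] that by auto
    then show "Z i j v x * Z k l v x' = 0" using Z(2) that by auto
  qed
  define f where "f = (\<lambda>i j. form (Z 0 i) (Z 0 j))"
  \<comment> \<open>Only vertices over \<open>w 0\<close> can lie in both boundaries, so the defect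
    is the odd weight of this fibre.\<close>
  have comm: "f i j + f j i = 1" if "0 < i" "i < 5" "0 < j" "j < 5" "i \<noteq> j" for i j
  proof -
    have "f i j + f j i = (\<Sum>v\<in>V. bdry (Z 0 i) v * bdry (Z 0 j) v)"
      unfolding f_def using that by (intro form_commute Z(1)) auto
    also have "\<dots> = (\<Sum>v\<in>V. if \<phi> v = w 0 then y v else 0)"
    proof (intro sum.cong refl)
      fix v assume "v \<in> V"
      moreover have "y v * y v = y v" by (cases "y v") simp_all
      ultimately show "bdry (Z 0 i) v * bdry (Z 0 j) v = (if \<phi> v = w 0 then y v else 0)"
        using that neq[of 0 i] neq[of 0 j] neq[of i j] by (auto simp: Z(3))
    qed
    also have "\<dots> = sum y {v \<in> V. \<phi> v = w 0}" using fin by (simp add: sum.inter_filter)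
    also have "\<dots> = 1" using w(2) by (intro modelD1[OF M]) auto
    finally show ?thesis .
  qed
  have form_T: "form (T i j) (T k l) = f i k + f i l + f j k + f j l"
    if "0 < i" "i < 5" "0 < j" "j < 5" "0 < k" "k < 5" "0 < l" "l < 5"
      "i \<noteq> j" "k \<noteq> l" "i \<noteq> k" "i \<noteq> l" "j \<noteq> k" "j \<noteq> l" for i j k l
    using that unfolding T_def f_def
    by (simp add: form_add_left form_add_right disj add.assoc)
  \<comment> \<open>Terms with index 1 occur twice and cancel; the other six form three pairs of
    value 1.\<close>
  have "form (T 1 2) (T 3 4) + form (T 1 3) (T 2 4) + form (T 1 4) (T 2 3)
    = (f 2 3 + f 3 2) + (f 2 4 + f 4 2) + (f 3 4 + f 4 3)"
    by (simp add: form_T ac_simps)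
  also have "\<dots> = 1" by (simp add: comm)
  finally consider "form (T 1 2) (T 3 4) = 1" | "form (T 1 3) (T 2 4) = 1" | "form (T 1 4) (T 2 3) = 1"
    by (metis add_0 bit_not_one_iff zero_neq_one)
  then show ?thesis
  proof cases
    case 1
    then show ?thesis using T[of 1 2] T[of 3 4] supp[of 1 2] supp[of 3 4] by force
  next
    case 2
    then show ?thesis using T[of 1 3] T[of 2 4] supp[of 1 3] supp[of 2 4] by force
  next
    case 3
    then show ?thesis using T[of 1 4] T[of 2 3] supp[of 1 4] supp[of 2 3] by force
  qed
qed

text \<open>Cycles over disjoint blocks of five fibres share no vertex, so the crossing pairs have
  the identity as their intersection matrix.\<close>

lemma model_genus:
  assumes M: "model V E W \<phi> 1 y" and "finite W" "5 * m \<le> card W"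
  shows "int m \<le> scheme_genus G \<pi> sg"
proof -
  obtain f where f: "inj_on f {..<5 * m}" "f ` {..<5 * m} \<subseteq> W"
    using card_le_inj[of "{..<5 * m}" W] assms(2,3) by auto
  define w where "w = (\<lambda>i j. f (5 * i + j))"
  have w_eq: "i = i' \<and> j = j'" if "w i j = w i' j'" "i < m" "i' < m" "j < 5" "j' < 5" for i j i' j'
  proof -
    have "f (5 * i + j) = f (5 * i' + j')" using that(1) by (simp add: w_def)
    moreover have "5 * i + j < 5 * m" "5 * i' + j' < 5 * m" using that(2-5) by linarith+
    ultimately have eq: "5 * i + j = 5 * i' + j'" by (intro inj_onD[OF f(1)]) simp_all
    have "i = (5 * i + j) div 5" "i' = (5 * i' + j') div 5" using that(4,5) by simp_all
    then have "i = i'" using eq by simp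
    then show ?thesis using eq by simp
  qed
  have wW: "w i ` {..<5} \<subseteq> W" if "i < m" for i using f(2) that by (force simp: w_def)
  have "inj_on (w i) {..<5}" if "i < m" for i using w_eq that by (auto intro: inj_onI)
  then have K5: "\<exists>a b. cyc a \<and> cyc b \<and> form a b = 1 \<and>
    (\<forall>v x. \<phi> v \<notin> w i ` {..<5} \<longrightarrow> a v x = 0 \<and> b v x = 0)" if "i < m" for i
    using crossing_cycles_K5[OF M _ wW] that by blast
  define Q where "Q = (\<lambda>i a b. i < m \<longrightarrow> cyc a \<and> cyc b \<and> form a b = 1 \<and>
    (\<forall>v x. \<phi> v \<notin> w i ` {..<5} \<longrightarrow> a v x = 0 \<and> b v x = 0))"
  have "\<exists>a b. Q i a b" for i using K5[of i] unfolding Q_def by blast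
  then obtain a b where "\<And>i. Q i (a i) (b i)" by metis
  then have ab: "i < m \<Longrightarrow> cyc (a i)" "i < m \<Longrightarrow> cyc (b i)" "i < m \<Longrightarrow> form (a i) (b i) = 1"
    "i < m \<Longrightarrow> \<phi> v \<notin> w i ` {..<5} \<Longrightarrow> a i v x = 0"
    "i < m \<Longrightarrow> \<phi> v \<notin> w i ` {..<5} \<Longrightarrow> b i v x = 0" for i v x
    unfolding Q_def by blast+
  have "form (a i) (b j) = of_bool (i = j)" if ij: "i < m" "j < m" for i j
  proof (cases "i = j")
    case False
    have "form (a i) (b j) = 0"
    proof (rule form_disjoint)
      fix v x x'
      have "w i ` {..<5} \<inter> w j ` {..<5} = {}" using w_eq ij False by auto
      then have "\<phi> v \<notin> w i ` {..<5} \<or> \<phi> v \<notin> w j ` {..<5}" by blast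
      then show "a i v x * b j v x' = 0" using ab(4,5) ij by auto
    qed
    then show ?thesis using False by simp
  qed (use ab ij in simp)
  then show ?thesis using genus_lower_bound[of m a b] ab(1,2) by blast
qed

end

lemma scheme_genus_model:
  fixes G :: "'a :: linorder pair_pre_digraph"
  assumes G: "pair_graph G" and \<pi>: "rotation_system G \<pi>"
    and M: "model (pverts G) (parcs G) W \<phi> 1 y" "finite W" "5 * m \<le> card W"
  shows "int m \<le> scheme_genus G \<pi> sg"
proof -
  have "\<exists>d e. bij_betw e {..<d} (nbrs G v) \<and> (\<forall>i. \<pi> v (e i) = e (Suc i)) \<and> e d = e 0"
    if "v \<in> pverts G" for v
    using that \<pi> by (intro cyclic_enumeration finite_nbrs[OF G]) (simp add: rotation_system_def)
  then obtain d e where de: "\<And>v. v \<in> pverts G \<Longrightarrow> bij_betw (e v) {..<d v} (nbrs G v) \<and>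
      (\<forall>i. \<pi> v (e v i) = e v (Suc i)) \<and> e v (d v) = e v 0"
    by metis
  interpret embedding G \<pi> sg d e
    using G \<pi> de by (intro embedding.intro) (auto simp: rotation_system_def)
  show ?thesis using M by (rule model_genus)
qed

section \<open>The minima in the definitions are attained\<close>

lemma exists_cyclic_permutation:
  assumes "finite S" "S \<noteq> {}"
  shows "\<exists>f. f permutes S \<and> cyclic_on f S"
proof -
  define n where "n = card S"
  have "n > 0" using assms by (simp add: n_def card_gt_0_iff)
  obtain h where h: "bij_betw h {..<n} S"
    using ex_bij_betw_nat_finite[OF assms(1)] by (auto simp: n_def lessThan_atLeast0)
  define f where "f = (\<lambda>x. if x \<in> S then h (Suc (inv_into {..<n} h x) mod n) else x)"
  have hS: "h (i mod n) \<in> S" for i using h \<open>n > 0\<close> by (auto simp: bij_betw_def)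
  have f: "f (h (i mod n)) = h (Suc i mod n)" for i
  proof -
    have "inv_into {..<n} h (h (i mod n)) = i mod n"
      using h \<open>n > 0\<close> by (intro inv_into_f_f) (auto simp: bij_betw_def)
    then show ?thesis using hS by (simp add: f_def mod_Suc_eq)
  qed
  have pow: "(f ^^ k) (h 0) = h (k mod n)" for k
    by (induction k) (simp_all add: f)
  have "orbit f (h 0) = S"
  proof (intro equalityI subsetI)
    fix x assume "x \<in> orbit f (h 0)"
    then show "x \<in> S" using hS by (auto simp: orbit_altdef pow)
  next
    fix x assume "x \<in> S"
    then obtain i where i: "i < n" "x = h i" using h by (auto simp: bij_betw_def)
    \<comment> \<open>One extra round, since \<open>orbit\<close> contains positive iterates
      only.\<close>
    then have "x = (f ^^ (i + n)) (h 0)" by (simp add: pow)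
    then show "x \<in> orbit f (h 0)" using \<open>n > 0\<close> unfolding orbit_altdef by blast
  qed
  moreover have "h 0 \<in> S" using hS[of 0] by simp
  ultimately have "cyclic_on f S" unfolding cyclic_on_def by metis
  have "f ` S = S"
  proof (intro equalityI subsetI)
    fix x assume "x \<in> f ` S"
    then show "x \<in> S" using hS by (auto simp: f_def)
  next
    fix x assume "x \<in> S"
    then obtain i where i: "i < n" "x = h i" using h by (auto simp: bij_betw_def)
    then have "x = f (h ((i + n - 1) mod n))" using f[of "i + n - 1"] \<open>n > 0\<close> by simp
    then show "x \<in> f ` S" using hS by blast
  qed
  then have "bij_betw f S S"
    using assms(1) eq_card_imp_inj_on[of S f] by (simp add: bij_betw_def)
  then have "f permutes S" by (rule bij_imp_permutes) (simp add: f_def)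
  then show ?thesis using \<open>cyclic_on f S\<close> by blast
qed

lemma rotation_system_exists:
  assumes "pair_graph G"
  shows "\<exists>\<pi>. rotation_system G \<pi>"
proof -
  have "\<exists>f. f permutes nbrs G v \<and> (nbrs G v \<noteq> {} \<longrightarrow> cyclic_on f (nbrs G v))" for v
  proof (cases "nbrs G v = {}")
    case False
    have "finite (nbrs G v)" by (rule finite_nbrs) fact
    then show ?thesis using exists_cyclic_permutation False by blast
  qed (auto intro: permutes_id)
  then show ?thesis unfolding rotation_system_def by metis
qed

text \<open>A least number has the defining property only if some number has it; any rotation system
  provides one.\<close>

lemma euler_genus_attained:
  assumes "pair_graph G"
  shows "\<exists>\<pi> sg. rotation_system G \<pi> \<and> scheme_genus G \<pi> sg \<le> int (euler_genus G)"
proof -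
  obtain \<pi> where "rotation_system G \<pi>" using rotation_system_exists[OF assms] by blast
  define P where "P = (\<lambda>g. \<exists>\<pi> sg. rotation_system G \<pi> \<and> scheme_genus G \<pi> sg \<le> int g)"
  have "scheme_genus G \<pi> (\<lambda>_. True) \<le> int (nat (scheme_genus G \<pi> (\<lambda>_. True)))" by simp
  then have "P (nat (scheme_genus G \<pi> (\<lambda>_. True)))" using \<open>rotation_system G \<pi>\<close> unfolding P_def by blast
  then have "P (Least P)" by (rule LeastI)
  then show ?thesis by (simp add: P_def euler_genus_def)
qed

lemma torso_pverts:
  assumes "pair_graph G"
  shows "torso G (pverts G) = G"
proof -
  have "pverts (remove_verts G (pverts G)) = {}" by (simp add: remove_verts_def induced_def)
  then have "components (remove_verts G (pverts G)) = {}"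
    using pair_graph_induced[OF assms] by (simp add: components_eq remove_verts_def)
  then show ?thesis using pair_graph_arcs[OF assms] unfolding torso_def
    by (intro pair_pre_digraph.equality) auto
qed

text \<open>A witness for the minimum is the decomposition with a single bag and no deleted
  vertices, with the Euler genus as \<open>k\<close>.\<close>

lemma vortex_free_hadwiger_attained:
  assumes "pair_graph F"
  shows "F \<in> sum_class (near_genus_class (vortex_free_hadwiger F) (vortex_free_hadwiger F))
    (vortex_free_hadwiger F)"
proof -
  define T :: "nat pair_pre_digraph" where "T = \<lparr>pverts = {0}, parcs = {}\<rparr>"
  let ?k = "euler_genus (remove_verts F {})"
  interpret T: pair_graph T by unfold_locales (auto simp: T_def symmetric_def sym_def)
  have conn: "connected (with_proj T)"
    by (auto simp: connected_def strongly_connected_def T_def reachable_def parcs_mk_symmetric)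
  have "parcs T = {}" by (simp add: T_def)
  then have "\<not> T.cycle p" for p by (auto simp: T.cycle_def T.awalk_def)
  then have "tree_graph T" unfolding tree_graph_def using conn T.pair_graph by blast
  moreover have "induced T {0} = T" by (auto simp: induced_def T_def)
  moreover have "parcs F \<subseteq> pverts F \<times> pverts F" by (rule pair_graph_arcs[OF assms])
  ultimately have "tree_decomposition F T (\<lambda>_. pverts F)"
    unfolding tree_decomposition_def using conn by (auto simp: T_def)
  moreover have "F \<in> near_genus_class ?k ?k"
    unfolding near_genus_class_def using assms by (auto intro!: exI[of _ "{}"])
  ultimately have "F \<in> sum_class (near_genus_class ?k ?k) ?k"
    unfolding sum_class_def using assms torso_pverts[OF assms]
    by (auto simp: T_def intro!: exI[of _ T] exI[of _ "\<lambda>_. pverts F"])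
  then show ?thesis unfolding vortex_free_hadwiger_def
    by (rule LeastI[of "\<lambda>k. F \<in> sum_class (near_genus_class k k) k"])
qed

section \<open>Deleted vertices and the final count\<close>

text \<open>Fibres meeting \<open>S\<close> are given up and the others lose nothing, so the parity
  stays, in contrast to elimination.\<close>

lemma model_remove_verts:
  assumes "model (pverts G) (parcs G) W \<phi> \<sigma> y"
  shows "model (pverts (remove_verts G S)) (parcs (remove_verts G S)) (W - \<phi> ` S) \<phi> \<sigma> y"
proof -
  have V: "pverts (remove_verts G S) = pverts G - S" by (auto simp: remove_verts_def induced_def)
  have U: "{a \<in> pverts G - S. \<phi> a \<in> {w, w'}} = {a \<in> pverts G. \<phi> a \<in> {w, w'}}"
    if "w \<in> W - \<phi> ` S" "w' \<in> W - \<phi> ` S" for w w' using that by auto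
  have U1: "{a \<in> pverts G - S. \<phi> a = w} = {a \<in> pverts G. \<phi> a = w}" if "w \<in> W - \<phi> ` S" for w
    using that by auto
  have closed: "closed_in (parcs G) {a \<in> pverts G. \<phi> a \<in> {w, w'}} X"
    if "w \<in> W - \<phi> ` S" "w' \<in> W - \<phi> ` S"
      "closed_in (parcs (remove_verts G S)) {a \<in> pverts G. \<phi> a \<in> {w, w'}} X" for w w' X
    unfolding closed_in_def
  proof (intro conjI ballI impI)
    show XU: "X \<subseteq> {a \<in> pverts G. \<phi> a \<in> {w, w'}}" using that(3) by (simp add: closed_in_def)
    fix a b assume ab: "a \<in> X" "b \<in> {a \<in> pverts G. \<phi> a \<in> {w, w'}}" "(a, b) \<in> parcs G"
    then have "a \<in> pverts G - S" "b \<in> pverts G - S" using XU U[OF that(1,2)] by blast+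
    then have "(a, b) \<in> parcs (remove_verts G S)"
      using ab(3) by (simp add: remove_verts_def induced_def)
    then show "b \<in> X" using that(3) ab unfolding closed_in_def by blast
  qed
  show ?thesis
    unfolding model_def V
  proof (intro conjI ballI allI impI)
    fix w assume "w \<in> W - \<phi> ` S"
    then show "sum y {a \<in> pverts G - S. \<phi> a = w} = \<sigma>" using modelD1[OF assms] U1 by simp
  next
    fix w w' X assume w: "w \<in> W - \<phi> ` S" "w' \<in> W - \<phi> ` S"
      and X: "w \<noteq> w' \<and> closed_in (parcs (remove_verts G S)) {a \<in> pverts G - S. \<phi> a \<in> {w, w'}} X"
    then show "sum y X = 0"
      using closed[OF w] U[OF w] by (intro modelD2[OF assms, of w w']) auto
  qed
qed

text \<open>All structure is taken at the attained value \<open>j\<close>; the bound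
  \<open>j \<le> k\<close> then enters only through numbers, without comparing the classes for
  different parameters.\<close>

lemma no_model_if_vortex_free_hadwiger_le:
  fixes F :: "'a :: linorder pair_pre_digraph"
  assumes F: "pair_graph F" "vortex_free_hadwiger F \<le> k"
    and W: "finite W" "card W = 6 * k + 5"
  shows "\<not> model (pverts F) (parcs F) W \<phi> 1 y"
proof
  assume M: "model (pverts F) (parcs F) W \<phi> 1 y"
  define j where "j = vortex_free_hadwiger F"
  have "j \<le> k" using F(2) by (simp add: j_def)
  then have "j < card W" using W(2) by simp
  from vortex_free_hadwiger_attained[OF F(1), folded j_def]
  obtain X y' where X: "torso F X \<in> near_genus_class j j" "model X (parcs (torso F X)) W \<phi> 1 y'"
    using sum_class_model[OF _ M \<open>j < card W\<close>] by blast
  define G where "G = torso F X"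
  have "pverts G = X" by (simp add: G_def torso_def)
  obtain S where G: "pair_graph G" and S: "S \<subseteq> pverts G" "card S \<le> j"
    and genus: "euler_genus (remove_verts G S) \<le> j"
    using X(1) unfolding near_genus_class_def G_def by blast
  have R: "pair_graph (remove_verts G S)" unfolding remove_verts_def by (rule pair_graph_induced[OF G])
  obtain \<pi> sg where \<pi>: "rotation_system (remove_verts G S) \<pi>"
    "scheme_genus (remove_verts G S) \<pi> sg \<le> int (euler_genus (remove_verts G S))"
    using euler_genus_attained[OF R] by blast
  have "model (pverts G) (parcs G) W \<phi> 1 y'" using X(2) by (simp add: G_def torso_def)
  then have M': "model (pverts (remove_verts G S)) (parcs (remove_verts G S)) (W - \<phi> ` S) \<phi> 1 y'"
    by (rule model_remove_verts)
  have "finite S" using S(1) pair_graph_finite[OF G] finite_subset by blast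
  then have "card (\<phi> ` S) \<le> j" using card_image_le[of S \<phi>] S(2) by linarith
  \<comment> \<open>At most \<open>j\<close> of the \<open>6 * k + 5\<close> fibres meet
    \<open>S\<close>. Five remain for each of \<open>k + 1\<close> disjoint copies, one copy more
    than Euler genus \<open>k\<close> allows.\<close>
  then have "5 * (k + 1) \<le> card (W - \<phi> ` S)"
    using diff_card_le_card_Diff[of "\<phi> ` S" W] \<open>finite S\<close> W(2) \<open>j \<le> k\<close> by simp
  then have "int (k + 1) \<le> scheme_genus (remove_verts G S) \<pi> sg"
    using scheme_genus_model[OF R \<pi>(1) M'] W(1) by blast
  then show False using \<pi>(2) genus \<open>j \<le> k\<close> by linarith
qed

theorem theorem1p2:
  fixes k :: nat
  shows "\<exists>(G :: nat pair_pre_digraph) (H :: nat pair_pre_digraph).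
    pair_graph G \<and> pair_graph H \<and> \<not> isomorphic G H \<and>
    hom_indistinguishable
      {F :: nat pair_pre_digraph. pair_graph F \<and> vortex_free_hadwiger F \<le> k} G H"
proof (intro exI conjI)
  let ?n = "6 * k + 5"
  show "pair_graph (cfi ?n False)" "pair_graph (cfi ?n True)" by (rule pair_graph_cfi)+
  show "\<not> isomorphic (cfi ?n False) (cfi ?n True)" by (rule cfi_not_isomorphic) simp
  show "hom_indistinguishable {F :: nat pair_pre_digraph. pair_graph F \<and> vortex_free_hadwiger F \<le> k}
      (cfi ?n False) (cfi ?n True)"
    unfolding hom_indistinguishable_def
  proof
    fix F :: "nat pair_pre_digraph"
    assume "F \<in> {F. pair_graph F \<and> vortex_free_hadwiger F \<le> k}"
    then have F: "pair_graph F" "vortex_free_hadwiger F \<le> k" by auto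
    show "hom_count F (cfi ?n False) = hom_count F (cfi ?n True)"
      using no_model_if_vortex_free_hadwiger_le[OF F, of "{..<?n}"]
      by (intro hom_count_cfi_eq F(1)) simp
  qed
qed

end
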